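(* Under the hard-cluster flat model with parameters $(N,K,\tau)$, as $N\to\infty$, strong detection is possible with the interval test (window length $2\pi\tau$) in each of the following regimes. (i) $K\ge2$ fixed and $\tau=o\big(N^{-1-\frac1{K-1}}\big)$. (ii) $K=N^\alpha$ with $0<\alpha\le1/2$, and $\tau=\frac{K^2}{(2+\epsilon)N\log N}$ for some constant $\epsilon\in(0,1/2)$. Here the threshold is $\gamma_N=(N-K)\tau+K-c_N\sqrt{(N-K)\tau}$ with $c_N$ chosen so that $c_N\to\infty$ and $c_N=o(\sqrt{\log N})$. (iii) $K=N^\alpha$ with $1/2<\alpha<1$, and $\tau\in(0,1-\epsilon]$ for some constant $\epsilon\in(0,1)$. Here the threshold is $\gamma_N=(N-K)\tau+K-c_N\sqrt{(N-K)\tau}$ with $c_N$ chosen so that $c_N\to\infty$ and $c_N=o\big(K/\sqrt{N\tau}\big)$.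
   Context: Hard-cluster flat model $(N,K,\tau)$, with $1\le K\le N$ an integer and $\tau\in(0,1)$ (both possibly depending on $N$): angles $X=(X_1,\dots,X_N)\in[0,2\pi)^N$ are observed. Under $H_0$ (law $\mathbb{Q}$) the $X_i$ are i.i.d. uniform on $[0,2\pi)$. Under $H_1$ (law $\mathbb{P}$), a subset $S^*\subset[N]$ is drawn uniformly at random among subsets of size $K$, a phase $\Theta^*$ is drawn independently and uniformly on $[0,2\pi)$, and given $(S^*,\Theta^* )$ the $X_i$ are independent with $X_i$ uniform on the arc $[\Theta^*,\Theta^*+2\pi\tau]$ (mod $2\pi$) for $i\in S^*$ and $X_i$ uniform on $[0,2\pi)$ for $i\notin S^*$. All arcs are understood modulo $2\pi$. $K=N^\alpha$ is understood up to rounding to an integer. A test is a measurable function $\phi$ of the data with values in $\{0,1\}$ ($1$ means reject $H_0$). $p_{\mathrm{fa}}(\phi)=\mathbb{Q}\{\phi(X)=1\}$ and $p_{\mathrm{miss}}(\phi)=\mathbb{P}\{\phi(X)=0\}$. Strong detection is possible if some sequence of tests has $p_{\mathrm{fa}}\to0$ and $p_{\mathrm{miss}}\to0$. Interval test with window length $2\pi\tau$ and threshold $\gamma$: reject $H_0$ if and only if $\sup_{\theta\in[0,2\pi)}\sum_{i=1}^N\mathbf{1}\{X_i\in[\theta,\theta+2\pi\tau]\}\ge\gamma$. $\log$ is the natural logarithm. *)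

theory Defs
  imports "HOL-Probability.Probability" "HOL-Library.Landau_Symbols"
begin

definition circle :: "real measure" where
  "circle = restrict_space lborel {0..<2*pi}"

text \<open>The closed arc \<open>[\<theta>, \<theta> + 2\<pi>\<tau>]\<close> modulo \<open>2\<pi>\<close>, by its representatives in \<open>[0, 2\<pi>)\<close>.\<close>

definition arc_mod :: "real \<Rightarrow> real \<Rightarrow> real set" where
  "arc_mod \<theta> \<tau> = {x \<in> {0..<2*pi}. \<exists>k::int. x + 2 * pi * of_int k \<in> {\<theta>..\<theta> + 2*pi*\<tau>}}"

definition unif :: "real set \<Rightarrow> real measure" where
  "unif A = uniform_measure circle A"

definition data_space :: "nat \<Rightarrow> (nat \<Rightarrow> real) measure" where
  "data_space N = (\<Pi>\<^sub>M i\<in>{..<N}. circle)"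

definition law_H0 :: "nat \<Rightarrow> (nat \<Rightarrow> real) measure" where
  "law_H0 N = (\<Pi>\<^sub>M i\<in>{..<N}. unif {0..<2*pi})"

definition cond_law :: "nat \<Rightarrow> real \<Rightarrow> nat set \<Rightarrow> real \<Rightarrow> (nat \<Rightarrow> real) measure" where
  "cond_law N \<tau> S \<theta> =
     (\<Pi>\<^sub>M i\<in>{..<N}. if i \<in> S then unif (arc_mod \<theta> \<tau>) else unif {0..<2*pi})"

text \<open>Only meaningful for \<open>K \<le> N\<close>, since \<open>pmf_of_set {}\<close> is unspecified, and \<open>0 < \<tau> < 1\<close>.
  The kernel is measurable for \<open>\<tau> > 0\<close> (\<open>measurable_cond_law\<close>), so neither \<open>bind\<close> is degenerate.\<close>

definition law_H1 :: "nat \<Rightarrow> nat \<Rightarrow> real \<Rightarrow> (nat \<Rightarrow> real) measure" where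
  "law_H1 N K \<tau> =
     measure_pmf (pmf_of_set {S. S \<subseteq> {..<N} \<and> card S = K}) \<bind>
       (\<lambda>S. unif {0..<2*pi} \<bind> (\<lambda>\<theta>. cond_law N \<tau> S \<theta>))"

lemma space_circle [simp]: "space circle = {0..<2*pi}"
  by (simp add: circle_def space_restrict_space)

lemma sets_circle_iff: "A \<in> sets circle \<longleftrightarrow> A \<in> sets borel \<and> A \<subseteq> {0..<2*pi}"
  by (auto simp: circle_def sets_restrict_space_iff)

lemma emeasure_circle: "A \<subseteq> {0..<2*pi} \<Longrightarrow> emeasure circle A = emeasure lborel A"
  by (simp add: circle_def emeasure_restrict_space)

lemma finite_measure_circle: "finite_measure circle"
  by (rule finite_measureI) (simp add: emeasure_circle)

lemma arc_mod_sets [measurable]: "arc_mod \<theta> \<tau> \<in> sets circle"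
proof -
  have "{x \<in> space borel. 0 \<le> x \<and> x < 2*pi \<and> (\<exists>k::int. \<theta> \<le> x + 2 * pi * of_int k \<and>
      x + 2 * pi * of_int k \<le> \<theta> + 2*pi*\<tau>)} \<in> sets borel"
    by measurable
  also have "{x \<in> space borel. 0 \<le> x \<and> x < 2*pi \<and> (\<exists>k::int. \<theta> \<le> x + 2 * pi * of_int k \<and>
      x + 2 * pi * of_int k \<le> \<theta> + 2*pi*\<tau>)} = arc_mod \<theta> \<tau>"
    by (auto simp: arc_mod_def)
  finally show ?thesis by (auto simp: sets_circle_iff arc_mod_def)
qed

lemma sets_unif [simp, measurable_cong]: "sets (unif A) = sets circle"
  and space_unif [simp]: "space (unif A) = {0..<2*pi}"
  by (simp_all add: unif_def)

lemma emeasure_arc_mod_pos: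
  assumes "\<theta> \<in> {0..<2*pi}" "0 < \<tau>"
  shows "emeasure circle (arc_mod \<theta> \<tau>) \<noteq> 0"
proof
  assume 0: "emeasure circle (arc_mod \<theta> \<tau>) = 0"
  let ?u = "min (\<theta> + 2*pi*\<tau>) (2*pi)"
  have sub: "{\<theta>..<?u} \<subseteq> arc_mod \<theta> \<tau>"
    using assms by (auto simp: arc_mod_def intro!: exI[of _ 0])
  have "emeasure lborel {\<theta>..<?u} = emeasure circle {\<theta>..<?u}"
    using assms by (subst emeasure_circle) auto
  also have "\<dots> \<le> emeasure circle (arc_mod \<theta> \<tau>)"
    by (rule emeasure_mono[OF sub]) measurable
  finally have "emeasure lborel {\<theta>..<?u} = 0" using 0 by simp
  moreover have "\<theta> < ?u" using assms by simp
  moreover from this have "emeasure lborel {\<theta>..<?u} = ennreal (?u - \<theta>)"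
    by (intro emeasure_lborel_Ico) linarith
  ultimately have "ennreal (?u - \<theta>) = 0" "0 < ?u - \<theta>" by (metis, linarith)
  then show False by (metis ennreal_eq_0_iff not_le)
qed

lemma prob_space_unif:
  assumes "emeasure circle A \<noteq> 0"
  shows "prob_space (unif A)"
proof -
  interpret finite_measure circle by (rule finite_measure_circle)
  show ?thesis using assms by (auto simp: unif_def intro!: prob_space_uniform_measure)
qed

lemma prob_space_unif_circle: "prob_space (unif {0..<2*pi})"
  by (rule prob_space_unif) (simp add: emeasure_circle ennreal_eq_0_iff not_le)

lemma prob_space_unif_arc:
  "\<theta> \<in> {0..<2*pi} \<Longrightarrow> 0 < \<tau> \<Longrightarrow> prob_space (unif (arc_mod \<theta> \<tau>))"
  by (intro prob_space_unif emeasure_arc_mod_pos)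

lemma sets_cond_law: "sets (cond_law N \<tau> S \<theta>) = sets (data_space N)"
  unfolding cond_law_def data_space_def by (rule sets_PiM_cong) auto

lemma sets_law_H0: "sets (law_H0 N) = sets (data_space N)"
  unfolding law_H0_def data_space_def by (rule sets_PiM_cong) auto

lemma prob_space_law_H0: "prob_space (law_H0 N)"
  unfolding law_H0_def by (intro prob_space_PiM prob_space_unif_circle)

lemma measurable_emeasure_arc:
  assumes A: "A \<in> sets circle"
  shows "(\<lambda>\<theta>. emeasure circle (arc_mod \<theta> \<tau> \<inter> A)) \<in> borel_measurable circle"
proof -
  interpret finite_measure circle by (rule finite_measure_circle)
  have id [measurable]: "(\<lambda>x. x) \<in> borel_measurable circle"
    unfolding circle_def by (rule measurable_restrict_space1) simp
  have [measurable]: "fst \<in> borel_measurable (circle \<Otimes>\<^sub>M circle)"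
      "snd \<in> borel_measurable (circle \<Otimes>\<^sub>M circle)"
    using measurable_compose[OF measurable_fst id] measurable_compose[OF measurable_snd id]
    by simp_all
  have [measurable]: "A \<in> sets borel" using A by (simp add: sets_circle_iff)
  have "{p \<in> space (circle \<Otimes>\<^sub>M circle). snd p \<in> A \<and>
      (\<exists>k::int. fst p \<le> snd p + 2 * pi * of_int k \<and>
        snd p + 2 * pi * of_int k \<le> fst p + 2*pi*\<tau>)} \<in> sets (circle \<Otimes>\<^sub>M circle)"
    by measurable
  also have "{p \<in> space (circle \<Otimes>\<^sub>M circle). snd p \<in> A \<and>
      (\<exists>k::int. fst p \<le> snd p + 2 * pi * of_int k \<and>
        snd p + 2 * pi * of_int k \<le> fst p + 2*pi*\<tau>)} =
      {p \<in> space (circle \<Otimes>\<^sub>M circle). snd p \<in> arc_mod (fst p) \<tau> \<inter> A}"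
    by (rule Collect_cong)
      (simp add: arc_mod_def space_pair_measure mem_Times_iff conj_commute cong: conj_cong)
  finally show ?thesis
    by (rule measurable_emeasure[rotated]) (auto simp: arc_mod_def)
qed

lemma measurable_cond_law:
  assumes "0 < \<tau>"
  shows "cond_law N \<tau> S \<in> circle \<rightarrow>\<^sub>M prob_algebra (data_space N)"
proof (rule measurable_prob_algebra_generated[where
      \<Omega> = "\<Pi>\<^sub>E i\<in>{..<N}. space circle" and G = "prod_algebra {..<N} (\<lambda>_. circle)"])
  show "sets (data_space N) = sigma_sets (\<Pi>\<^sub>E i\<in>{..<N}. space circle) (prod_algebra {..<N} (\<lambda>_. circle))"
    unfolding data_space_def by (rule sets_PiM)
  show "Int_stable (prod_algebra {..<N} (\<lambda>_. circle))" by (rule Int_stable_prod_algebra)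
  show "prod_algebra {..<N} (\<lambda>_. circle) \<subseteq> Pow (\<Pi>\<^sub>E i\<in>{..<N}. space circle)"
    by (rule prod_algebra_sets_into_space)
  have ps: "prob_space (if i \<in> S then unif (arc_mod \<theta> \<tau>) else unif {0..<2*pi})"
    if "\<theta> \<in> space circle" for \<theta> i
    using that assms prob_space_unif_arc prob_space_unif_circle by auto
  show "prob_space (cond_law N \<tau> S \<theta>)" if "\<theta> \<in> space circle" for \<theta>
    unfolding cond_law_def by (intro prob_space_PiM ps that)
  show "sets (cond_law N \<tau> S \<theta>) = sets (data_space N)" for \<theta> by (rule sets_cond_law)
  fix B assume "B \<in> prod_algebra {..<N} (\<lambda>_. circle)"
  then obtain E where B: "B = Pi\<^sub>E {..<N} E" and E: "E \<in> (\<Pi> i\<in>{..<N}. sets circle)"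
    by (rule prod_algebraE_all)
  have eq: "emeasure (cond_law N \<tau> S \<theta>) B =
      (\<Prod>i<N. if i \<in> S
        then emeasure circle (arc_mod \<theta> \<tau> \<inter> E i) / emeasure circle (arc_mod \<theta> \<tau> \<inter> space circle)
        else emeasure (unif {0..<2*pi}) (E i))"
    if \<theta>: "\<theta> \<in> space circle" for \<theta>
  proof -
    let ?M = "\<lambda>i. if i \<in> S then unif (arc_mod \<theta> \<tau>) else unif {0..<2*pi}"
    interpret product_sigma_finite ?M
      by (intro product_sigma_finite.intro prob_space_imp_sigma_finite ps \<theta>)
    have "emeasure (cond_law N \<tau> S \<theta>) B = (\<Prod>i<N. emeasure (?M i) (E i))"
      unfolding cond_law_def B using E by (intro emeasure_PiM) (auto simp: Pi_iff)
    also have "\<dots> = (\<Prod>i<N. if i \<in> S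
        then emeasure circle (arc_mod \<theta> \<tau> \<inter> E i) / emeasure circle (arc_mod \<theta> \<tau> \<inter> space circle)
        else emeasure (unif {0..<2*pi}) (E i))"
    proof (rule prod.cong[OF refl])
      fix i assume "i \<in> {..<N}"
      then have "E i \<in> sets circle" using E by auto
      moreover have "arc_mod \<theta> \<tau> \<inter> space circle = arc_mod \<theta> \<tau>" by (auto simp: arc_mod_def)
      ultimately show "emeasure (?M i) (E i) = (if i \<in> S
        then emeasure circle (arc_mod \<theta> \<tau> \<inter> E i) / emeasure circle (arc_mod \<theta> \<tau> \<inter> space circle)
        else emeasure (unif {0..<2*pi}) (E i))"
        by (simp add: unif_def)
    qed
    finally show ?thesis .
  qed
  have "(\<lambda>\<theta>. \<Prod>i<N. if i \<in> S
        then emeasure circle (arc_mod \<theta> \<tau> \<inter> E i) / emeasure circle (arc_mod \<theta> \<tau> \<inter> space circle)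
        else emeasure (unif {0..<2*pi}) (E i)) \<in> borel_measurable circle"
  proof (rule borel_measurable_prod_ennreal)
    fix i assume "i \<in> {..<N}"
    then have "E i \<in> sets circle" using E by auto
    then show "(\<lambda>\<theta>. if i \<in> S
        then emeasure circle (arc_mod \<theta> \<tau> \<inter> E i) / emeasure circle (arc_mod \<theta> \<tau> \<inter> space circle)
        else emeasure (unif {0..<2*pi}) (E i)) \<in> borel_measurable circle"
      using measurable_emeasure_arc[of "E i" \<tau>] measurable_emeasure_arc[OF sets.top, of \<tau>]
      by (cases "i \<in> S") (auto intro!: borel_measurable_divide_ennreal)
  qed
  then show "(\<lambda>\<theta>. emeasure (cond_law N \<tau> S \<theta>) B) \<in> borel_measurable circle"
    using eq by (subst measurable_cong) auto
qed

lemma law_H1_in_prob_algebra: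
  assumes "0 < \<tau>"
  shows "law_H1 N K \<tau> \<in> space (prob_algebra (data_space N))"
proof -
  have inner: "unif {0..<2*pi} \<bind> cond_law N \<tau> S \<in> space (prob_algebra (data_space N))" for S
  proof -
    have m: "cond_law N \<tau> S \<in> unif {0..<2*pi} \<rightarrow>\<^sub>M prob_algebra (data_space N)"
      using measurable_cond_law[OF assms] by (simp cong: measurable_cong_sets)
    have u: "unif {0..<2*pi} \<in> space (prob_algebra (unif {0..<2*pi}))"
      using prob_space_unif_circle by (simp add: space_prob_algebra)
    show ?thesis
      using prob_space_bind'[OF u m] sets_bind'[OF u m] by (simp add: space_prob_algebra)
  qed
  let ?p = "measure_pmf (pmf_of_set {S. S \<subseteq> {..<N} \<and> card S = K})"
  have m: "(\<lambda>S. unif {0..<2*pi} \<bind> cond_law N \<tau> S) \<in> ?p \<rightarrow>\<^sub>M prob_algebra (data_space N)"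
    using inner by simp
  have p: "?p \<in> space (prob_algebra ?p)"
    by (simp add: space_prob_algebra measure_pmf.prob_space_axioms)
  show ?thesis
    using prob_space_bind'[OF p m] sets_bind'[OF p m]
    by (simp add: space_prob_algebra law_H1_def)
qed

lemma prob_space_law_H1: "0 < \<tau> \<Longrightarrow> prob_space (law_H1 N K \<tau>)"
  and sets_law_H1: "0 < \<tau> \<Longrightarrow> sets (law_H1 N K \<tau>) = sets (data_space N)"
  using law_H1_in_prob_algebra by (auto simp: space_prob_algebra)

definition is_test :: "nat \<Rightarrow> ((nat \<Rightarrow> real) \<Rightarrow> nat) \<Rightarrow> bool" where
  "is_test N \<phi> \<longleftrightarrow> \<phi> \<in> data_space N \<rightarrow>\<^sub>M count_space {0, 1}"

definition p_fa :: "nat \<Rightarrow> ((nat \<Rightarrow> real) \<Rightarrow> nat) \<Rightarrow> real" where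
  "p_fa N \<phi> = measure (law_H0 N) {x \<in> space (data_space N). \<phi> x = 1}"

definition p_miss :: "nat \<Rightarrow> nat \<Rightarrow> real \<Rightarrow> ((nat \<Rightarrow> real) \<Rightarrow> nat) \<Rightarrow> real" where
  "p_miss N K \<tau> \<phi> = measure (law_H1 N K \<tau>) {x \<in> space (data_space N). \<phi> x = 0}"

definition strongly_detects ::
  "(nat \<Rightarrow> nat) \<Rightarrow> (nat \<Rightarrow> real) \<Rightarrow> (nat \<Rightarrow> (nat \<Rightarrow> real) \<Rightarrow> nat) \<Rightarrow> bool" where
  "strongly_detects K \<tau> \<phi> \<longleftrightarrow>
     (\<forall>N. is_test N (\<phi> N)) \<and>
     (\<lambda>N. p_fa N (\<phi> N)) \<longlonglongrightarrow> 0 \<and>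
     (\<lambda>N. p_miss N (K N) (\<tau> N) (\<phi> N)) \<longlonglongrightarrow> 0"

definition interval_test :: "nat \<Rightarrow> real \<Rightarrow> real \<Rightarrow> (nat \<Rightarrow> real) \<Rightarrow> nat" where
  "interval_test N \<tau> \<gamma> x =
     (if (SUP \<theta>\<in>{0..<2*pi}. \<Sum>i<N. indicat_real (arc_mod \<theta> \<tau>) (x i)) \<ge> \<gamma> then 1 else 0)"

definition threshold :: "nat \<Rightarrow> nat \<Rightarrow> real \<Rightarrow> real \<Rightarrow> real" where
  "threshold N K \<tau> c =
     (real N - real K) * \<tau> + real K - c * sqrt ((real N - real K) * \<tau>)"

text \<open>\<open>K = N\<^sup>\<alpha>\<close> up to rounding; either direction of rounding is allowed, and may vary with \<open>N\<close>.\<close>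

definition rounded_power :: "(nat \<Rightarrow> nat) \<Rightarrow> real \<Rightarrow> bool" where
  "rounded_power K \<alpha> \<longleftrightarrow>
     (\<forall>N. K N = nat \<lfloor>real N powr \<alpha>\<rfloor> \<or> K N = nat \<lceil>real N powr \<alpha>\<rceil>)"

end

theory Submission
  imports Defs "HOL-Real_Asymp.Real_Asymp"
begin

text \<open>
  Write \<open>C(\<theta>)\<close> for the number of data points in the arc of length \<open>2\<pi>\<tau>\<close> starting at \<open>\<theta>\<close>; the interval
  test rejects when \<open>sup C\<close> reaches \<open>\<gamma>\<close>. Both error probabilities reduce to Chernoff bounds for
  binomial variables, which rest on the exact moment generating functions \<open>mgf_data_point_H0\<close> and
  \<open>mgf_cond_law\<close>.

  False alarms. An arc with at least one data point can be rotated until it starts at one of the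
  points it contains, without losing any of them (\<open>arc_count_le_at_data_point\<close>). So the supremum over
  a continuum of arcs is a maximum over the \<open>N\<close> arcs starting at the data. This gives measurability,
  and it allows a union bound: conditionally on \<open>X\<^sub>j\<close>, the count \<open>C(X\<^sub>j)\<close> is \<open>1 + Bin(N - 1, \<tau>)\<close> under
  the null hypothesis. Hence \<open>p_fa\<close> is at most \<open>N exp(- s (\<gamma> - 1) + N \<tau> (e\<^sup>s - 1))\<close> for every
  \<open>s \<ge> 0\<close> (\<open>p_fa_le\<close>).

  Misses. Given the planted set and the planted phase \<open>\<theta>\<close>, the planted arc alone holds
  \<open>C(\<theta>) \<sim> K + Bin(N - K, \<tau>)\<close> points. The lower tail of the binomial bounds \<open>p_miss\<close> (\<open>p_miss_le\<close>). The
  threshold lies \<open>c\<close> times \<open>sqrt ((N - K) \<tau>)\<close> below the mean of \<open>C(\<theta>)\<close>, so \<open>p_miss\<close> is at most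
  \<open>exp(- c\<^sup>2 / 4)\<close> (\<open>p_miss_threshold_le\<close>), which vanishes as \<open>c \<rightarrow> \<infinity>\<close>.

  In each regime it remains to choose \<open>s\<close> for the false alarms.

  For fixed \<open>K\<close> take \<open>\<gamma> = K\<close> and \<open>e\<^sup>s = 1 / (N \<tau>)\<close>. The bound is \<open>e N (N \<tau>) powr (K - 1)\<close>, which tends to \<open>0\<close>
  exactly when \<open>\<tau> = o(N powr (- 1 - 1 / (K - 1)))\<close>. The planted arc contains \<open>K\<close> points almost surely.

  For \<open>\<alpha> \<le> 1/2\<close> the excess \<open>\<gamma> - 1 - N \<tau>\<close> is \<open>K (1 - o(1))\<close>, since \<open>\<tau> \<rightarrow> 0\<close> and \<open>c\<close> is small, and the mean
  is \<open>N \<tau> = K\<^sup>2 / ((2 + \<epsilon>) ln N)\<close>. The Gaussian optimum \<open>s = K / (N \<tau>) = (2 + \<epsilon>) ln N / K\<close> tends to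
  \<open>0\<close>, so the quadratic expansion of \<open>e\<^sup>s\<close> is accurate, and the binomial tail is
  \<open>N powr (- (1 + \<epsilon>/2) (1 - o(1)))\<close>. This beats the factor \<open>N\<close> of the union bound.

  For \<open>\<alpha> > 1/2\<close> the excess is at least \<open>\<epsilon> K / 2\<close> while the standard deviation is at most \<open>sqrt N\<close>. As
  \<open>K\<^sup>2 / N\<close> grows like a power of \<open>N\<close>, a crude choice of \<open>s\<close> of order \<open>K / N\<close> is enough.
\<close>

section \<open>Reduction of the scan statistic to arcs starting at data points\<close>

text \<open>The index set is a parameter so that the point at which an arc starts can be split off from the rest.\<close>

definition arc_count :: "nat set \<Rightarrow> real \<Rightarrow> (nat \<Rightarrow> real) \<Rightarrow> real \<Rightarrow> nat" where
  "arc_count I \<tau> x \<theta> = card {i \<in> I. x i \<in> arc_mod \<theta> \<tau>}"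

lemma sum_indicator_eq_arc_count:
  assumes "finite I"
  shows "(\<Sum>i\<in>I. indicat_real (arc_mod \<theta> \<tau>) (x i)) = real (arc_count I \<tau> x \<theta>)"
proof -
  have "(\<Sum>i\<in>I. indicat_real (arc_mod \<theta> \<tau>) (x i)) = (\<Sum>i\<in>I. if x i \<in> arc_mod \<theta> \<tau> then 1 else 0)"
    by (intro sum.cong) (auto simp: indicator_def)
  also have "\<dots> = real (arc_count I \<tau> x \<theta>)"
    using assms by (subst sum.If_cases) (auto simp: arc_count_def Int_def)
  finally show ?thesis .
qed

lemma interval_test_eq_1_iff:
  "interval_test N \<tau> \<gamma> x = 1 \<longleftrightarrow> (\<exists>\<theta>\<in>{0..<2*pi}. \<gamma> \<le> real (arc_count {..<N} \<tau> x \<theta>))"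
proof -
  let ?f = "\<lambda>\<theta>. real (arc_count {..<N} \<tau> x \<theta>)"
  let ?A = "{0..<2*pi}"
  have "arc_count {..<N} \<tau> x \<theta> \<le> N" for \<theta>
    unfolding arc_count_def by (rule order.trans[OF card_mono[of "{..<N}"]]) auto
  then have "?f ` ?A \<subseteq> real ` {..N}" by auto
  then have fin: "finite (?f ` ?A)" by (rule finite_subset) simp
  have ne: "?f ` ?A \<noteq> {}" by simp
  have "\<gamma> \<le> (SUP \<theta>\<in>?A. ?f \<theta>) \<longleftrightarrow> (\<exists>\<theta>\<in>?A. \<gamma> \<le> ?f \<theta>)"
    using Max_ge_iff[OF fin ne, of \<gamma>] cSup_eq_Max[OF fin ne] by simp
  then show ?thesis
    by (simp add: interval_test_def sum_indicator_eq_arc_count)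
qed

text \<open>Among the points of the arc, take the one closest to its start \<open>\<theta>\<close> and rotate the arc until it
  starts there. The arc does not shrink, and every point it contained lies further along, hence is
  still covered. Representatives \<open>x i + 2\<pi>k\<close> inside \<open>[\<theta>, \<theta> + 2\<pi>\<tau>]\<close> turn the cyclic order into the order
  of the reals.\<close>

lemma arc_count_le_at_data_point:
  assumes "0 < arc_count {..<N} \<tau> x \<theta>"
  shows "\<exists>j<N. arc_count {..<N} \<tau> x \<theta> \<le> arc_count {..<N} \<tau> x (x j)"
proof -
  define T where "T = {i \<in> {..<N}. x i \<in> arc_mod \<theta> \<tau>}"
  have T: "finite T" "T \<noteq> {}" using assms by (auto simp: T_def arc_count_def card_gt_0_iff)
  have "\<exists>k::int. x i + 2 * pi * of_int k \<in> {\<theta>..\<theta> + 2*pi*\<tau>}" if "i \<in> T" for i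
    using that by (auto simp: T_def arc_mod_def)
  then obtain k :: "nat \<Rightarrow> int"
    where k: "x i + 2 * pi * of_int (k i) \<in> {\<theta>..\<theta> + 2*pi*\<tau>}" if "i \<in> T" for i
    by metis
  obtain j where j: "j \<in> T"
    and min: "\<And>i. i \<in> T \<Longrightarrow> x j + 2 * pi * of_int (k j) \<le> x i + 2 * pi * of_int (k i)"
    using ex_is_arg_min_if_finite[OF T, of "\<lambda>i. x i + 2 * pi * of_int (k i)"]
    unfolding is_arg_min_linorder by blast
  have "x i \<in> arc_mod (x j) \<tau>" if i: "i \<in> T" for i
  proof -
    have "x i \<in> {0..<2*pi}" using i by (auto simp: T_def arc_mod_def)
    moreover have "x i + 2 * pi * of_int (k i - k j) \<in> {x j..x j + 2*pi*\<tau>}"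
      using k[OF i] k[OF j] min[OF i] by (auto simp: algebra_simps)
    ultimately show ?thesis unfolding arc_mod_def by blast
  qed
  then have "T \<subseteq> {i \<in> {..<N}. x i \<in> arc_mod (x j) \<tau>}" by (auto simp: T_def)
  then have "card T \<le> arc_count {..<N} \<tau> x (x j)"
    unfolding arc_count_def by (intro card_mono) auto
  then show ?thesis using j by (auto simp: T_def arc_count_def)
qed

lemma interval_test_eq_1_iff_data_point:
  assumes "x \<in> space (data_space N)" "0 < \<gamma>"
  shows "interval_test N \<tau> \<gamma> x = 1 \<longleftrightarrow> (\<exists>j<N. \<gamma> \<le> real (arc_count {..<N} \<tau> x (x j)))"
proof
  assume "interval_test N \<tau> \<gamma> x = 1"
  then obtain \<theta> where "\<gamma> \<le> real (arc_count {..<N} \<tau> x \<theta>)"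
    unfolding interval_test_eq_1_iff by blast
  moreover from this \<open>0 < \<gamma>\<close> have "0 < arc_count {..<N} \<tau> x \<theta>" by linarith
  ultimately show "\<exists>j<N. \<gamma> \<le> real (arc_count {..<N} \<tau> x (x j))"
    using arc_count_le_at_data_point by (meson of_nat_le_iff order.trans)
next
  assume "\<exists>j<N. \<gamma> \<le> real (arc_count {..<N} \<tau> x (x j))"
  moreover have "x j \<in> {0..<2*pi}" if "j < N" for j
    using assms(1) that by (auto simp: data_space_def space_PiM PiE_iff)
  ultimately show "interval_test N \<tau> \<gamma> x = 1"
    unfolding interval_test_eq_1_iff by blast
qed

section \<open>Measurability of the test\<close>

lemma measurable_circle_borel [measurable]: "(\<lambda>x. x) \<in> borel_measurable circle"
  unfolding circle_def by (rule measurable_restrict_space1) simp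

lemma measurable_coordinate:
  "i < N \<Longrightarrow> (\<lambda>x. x i) \<in> borel_measurable (data_space N)"
  unfolding data_space_def
  by (rule measurable_compose[OF _ measurable_circle_borel], rule measurable_component_singleton) simp

lemma pred_mem_arc_mod:
  assumes [measurable]: "f \<in> borel_measurable M" "g \<in> borel_measurable M"
  shows "Measurable.pred M (\<lambda>x. f x \<in> arc_mod (g x) \<tau>)"
proof -
  have "Measurable.pred M (\<lambda>x. 0 \<le> f x \<and> f x < 2 * pi \<and>
      (\<exists>k::int. g x \<le> f x + 2 * pi * of_int k \<and> f x + 2 * pi * of_int k \<le> g x + 2*pi*\<tau>))"
    by measurable
  then show ?thesis by (simp add: arc_mod_def)
qed

lemma measurable_arc_count_data_point:
  assumes "j < N"
  shows "(\<lambda>x. real (arc_count {..<N} \<tau> x (x j))) \<in> borel_measurable (data_space N)"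
  unfolding sum_indicator_eq_arc_count[OF finite_lessThan, symmetric]
proof (rule borel_measurable_sum)
  fix i assume "i \<in> {..<N}"
  then have [measurable]: "Measurable.pred (data_space N) (\<lambda>x. x i \<in> arc_mod (x j) \<tau>)"
    using assms by (intro pred_mem_arc_mod measurable_coordinate) auto
  have "(\<lambda>x. if x i \<in> arc_mod (x j) \<tau> then 1 else 0 :: real) \<in> borel_measurable (data_space N)"
    by measurable
  then show "(\<lambda>x. indicat_real (arc_mod (x j) \<tau>) (x i)) \<in> borel_measurable (data_space N)"
    by (simp add: indicator_def of_bool_def cong: if_cong)
qed

lemma rejection_set_measurable:
  "{x \<in> space (data_space N). interval_test N \<tau> \<gamma> x = 1} \<in> sets (data_space N)"
proof (cases "0 < \<gamma>")
  case True
  have "{x \<in> space (data_space N). interval_test N \<tau> \<gamma> x = 1} =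
      (\<Union>j<N. {x \<in> space (data_space N). \<gamma> \<le> real (arc_count {..<N} \<tau> x (x j))})"
    using interval_test_eq_1_iff_data_point[OF _ True] by auto
  also have "\<dots> \<in> sets (data_space N)"
    using measurable_arc_count_data_point by (intro sets.finite_UN) auto
  finally show ?thesis .
next
  case False
  then have "interval_test N \<tau> \<gamma> x = 1" for x
    unfolding interval_test_eq_1_iff by (intro bexI[of _ 0]) (auto intro: order.trans[of _ 0])
  then show ?thesis by simp
qed

lemma is_test_interval_test: "is_test N (interval_test N \<tau> \<gamma>)"
proof -
  have two_valued: "interval_test N \<tau> \<gamma> x \<in> {0, 1}" for x by (simp add: interval_test_def)
  have 0: "{x \<in> space (data_space N). interval_test N \<tau> \<gamma> x = 0} =
      space (data_space N) - {x \<in> space (data_space N). interval_test N \<tau> \<gamma> x = 1}"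
    using two_valued by auto
  have "interval_test N \<tau> \<gamma> -` {a} \<inter> space (data_space N) \<in> sets (data_space N)"
    if "a \<in> {0, 1}" for a
  proof -
    have "{x \<in> space (data_space N). interval_test N \<tau> \<gamma> x = a} \<in> sets (data_space N)"
    proof (cases "a = 0")
      case True
      show ?thesis unfolding True 0 by (intro sets.compl_sets rejection_set_measurable)
    next
      case False
      then have "a = 1" using that by simp
      then show ?thesis using rejection_set_measurable by blast
    qed
    also have "{x \<in> space (data_space N). interval_test N \<tau> \<gamma> x = a} =
        interval_test N \<tau> \<gamma> -` {a} \<inter> space (data_space N)" by blast
    finally show ?thesis .
  qed
  moreover have "interval_test N \<tau> \<gamma> \<in> space (data_space N) \<rightarrow> {0, 1}"
    using two_valued by blast
  ultimately show ?thesis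
    unfolding is_test_def by (subst measurable_count_space_eq2) simp_all
qed

section \<open>Moment generating functions of arc counts\<close>

text \<open>The arc of relative length \<open>\<tau> < 1\<close> meets \<open>[0, 2\<pi>)\<close> in one interval, or in two disjoint ones when it
  wraps around; in both cases the lengths add up to \<open>2\<pi>\<tau>\<close>.\<close>

lemma measure_arc_mod:
  assumes \<theta>: "\<theta> \<in> {0..<2*pi}" and \<tau>: "0 < \<tau>" "\<tau> < 1"
  shows "measure lborel (arc_mod \<theta> \<tau>) = 2 * pi * \<tau>"
proof -
  have len: "0 < 2 * pi * \<tau>" "2 * pi * \<tau> < 2 * pi" using \<tau> by auto
  \<comment> \<open>The arc ends before \<open>4\<pi>\<close>, so it meets at most two periods.\<close>
  have shift: "k = 0 \<or> k = 1"
    if "x \<in> {0..<2*pi}" "x + 2 * pi * of_int k \<in> {\<theta>..\<theta> + 2*pi*\<tau>}" for x and k :: int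
  proof -
    have "2 * pi * (-1) < 2 * pi * real_of_int k" "2 * pi * real_of_int k < 2 * pi * 2"
      using that \<theta> len unfolding atLeastAtMost_iff atLeastLessThan_iff by linarith+
    then have "-1 < real_of_int k" "real_of_int k < 2"
      by (metis mult_less_cancel_left_pos pi_gt_zero mult_pos_pos zero_less_numeral)+
    then show ?thesis by auto
  qed
  have arc: "arc_mod \<theta> \<tau> = {x \<in> {0..<2*pi}. x \<in> {\<theta>..\<theta> + 2*pi*\<tau>} \<or> x + 2 * pi \<in> {\<theta>..\<theta> + 2*pi*\<tau>}}"
    (is "_ = ?R")
  proof (intro set_eqI iffI)
    fix x assume "x \<in> arc_mod \<theta> \<tau>"
    then obtain k :: int where "x \<in> {0..<2*pi}" "x + 2 * pi * of_int k \<in> {\<theta>..\<theta> + 2*pi*\<tau>}"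
      by (auto simp: arc_mod_def)
    with shift[OF this] show "x \<in> ?R" by auto
  next
    fix x assume "x \<in> ?R"
    then have "x \<in> {0..<2*pi}" and "x + 2 * pi * of_int 0 \<in> {\<theta>..\<theta> + 2*pi*\<tau>} \<or>
        x + 2 * pi * of_int 1 \<in> {\<theta>..\<theta> + 2*pi*\<tau>}" by auto
    then show "x \<in> arc_mod \<theta> \<tau>" unfolding arc_mod_def by blast
  qed
  show ?thesis
  proof (cases "\<theta> + 2*pi*\<tau> < 2 * pi")
    case True
    then have "arc_mod \<theta> \<tau> = {\<theta>..\<theta> + 2*pi*\<tau>}" unfolding arc using \<theta> len by auto
    then show ?thesis using len by simp
  next
    case False
    then have "arc_mod \<theta> \<tau> = {\<theta>..<2*pi} \<union> {0..\<theta> + 2*pi*\<tau> - 2 * pi}"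
      unfolding arc using \<theta> len
      by (intro set_eqI) (simp only: mem_Collect_eq Un_iff atLeastAtMost_iff atLeastLessThan_iff, linarith)
    moreover have "measure lborel ({\<theta>..<2*pi} \<union> {0..\<theta> + 2*pi*\<tau> - 2 * pi}) =
        measure lborel {\<theta>..<2*pi} + measure lborel {0..\<theta> + 2*pi*\<tau> - 2 * pi}"
    proof (rule measure_Union)
      show "{\<theta>..<2*pi} \<inter> {0..\<theta> + 2*pi*\<tau> - 2 * pi} = {}"
        using len(2) by (intro equals0I) (simp only: Int_iff atLeastAtMost_iff atLeastLessThan_iff, linarith)
      show "emeasure lborel {\<theta>..<2*pi} \<noteq> \<infinity>" using \<theta> by simp
      show "emeasure lborel {0..\<theta> + 2*pi*\<tau> - 2 * pi} \<noteq> \<infinity>" using False by simp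
    qed auto
    ultimately show ?thesis using \<theta> len False by simp
  qed
qed

lemma emeasure_circle_arc_mod:
  assumes "\<theta> \<in> {0..<2*pi}" "0 < \<tau>" "\<tau> < 1"
  shows "emeasure circle (arc_mod \<theta> \<tau>) = ennreal (2 * pi * \<tau>)"
proof -
  interpret finite_measure circle by (rule finite_measure_circle)
  have sub: "arc_mod \<theta> \<tau> \<subseteq> {0..<2*pi}" by (auto simp: arc_mod_def)
  have "measure circle (arc_mod \<theta> \<tau>) = measure lborel (arc_mod \<theta> \<tau>)"
    using emeasure_circle[OF sub] by (simp add: measure_def)
  then show ?thesis using measure_arc_mod[OF assms] by (simp add: emeasure_eq_measure)
qed

lemma measure_unif_circle_arc_mod:
  assumes "\<theta> \<in> {0..<2*pi}" "0 < \<tau>" "\<tau> < 1"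
  shows "measure (unif {0..<2*pi}) (arc_mod \<theta> \<tau>) = \<tau>"
proof -
  have "emeasure circle {0..<2*pi} = ennreal (2 * pi)" by (simp add: emeasure_circle)
  moreover have "{0..<2*pi} \<inter> arc_mod \<theta> \<tau> = arc_mod \<theta> \<tau>" by (auto simp: arc_mod_def)
  moreover have "{0..<2*pi} \<in> sets circle" by (simp add: sets_circle_iff)
  ultimately have "emeasure (unif {0..<2*pi}) (arc_mod \<theta> \<tau>) = ennreal (2 * pi * \<tau>) / ennreal (2 * pi)"
    unfolding unif_def by (simp add: emeasure_circle_arc_mod[OF assms] del: ennreal_mult'')
  also have "\<dots> = ennreal \<tau>" using assms by (subst divide_ennreal) auto
  finally show ?thesis using assms by (simp add: measure_def)
qed

lemma measurable_exp_indicator_arc: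
  "sets M = sets circle \<Longrightarrow> 
    (\<lambda>x. ennreal (exp (s * indicat_real (arc_mod \<theta> \<tau>) x))) \<in> borel_measurable M"
  by (subst measurable_cong_sets[of M circle borel borel]) (auto intro!: measurable_compose[OF borel_measurable_indicator])

lemma mgf_Bernoulli_nonneg:
  fixes \<tau> s :: real
  assumes "0 < \<tau>" "\<tau> < 1"
  shows "0 \<le> 1 + \<tau> * (exp s - 1)"
proof -
  have "0 \<le> (1 - \<tau>) + \<tau> * exp s" using assms by simp
  then show ?thesis by (simp add: algebra_simps)
qed

text \<open>The indicator of an arc under the uniform law is a Bernoulli variable with parameter \<open>\<tau>\<close>.\<close>

lemma mgf_unif_circle:
  assumes "\<theta> \<in> {0..<2*pi}" "0 < \<tau>" "\<tau> < 1"
  shows "(\<integral>\<^sup>+x. ennreal (exp (s * indicat_real (arc_mod \<theta> \<tau>) x)) \<partial>unif {0..<2*pi})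
    = ennreal (1 + \<tau> * (exp s - 1))"
proof -
  interpret prob_space "unif {0..<2*pi}" by (rule prob_space_unif_circle)
  let ?U = "unif {0..<2*pi}" and ?A = "arc_mod \<theta> \<tau>"
  have A [measurable]: "?A \<in> sets ?U" by simp
  have "(\<integral>\<^sup>+x. ennreal (exp (s * indicat_real ?A x)) \<partial>?U) =
      (\<integral>\<^sup>+x. ennreal (exp s) * indicator ?A x + 1 * indicator (space ?U - ?A) x \<partial>?U)"
    by (intro nn_integral_cong) (auto simp: indicator_def)
  also have "\<dots> = ennreal (exp s) * emeasure ?U ?A + 1 * emeasure ?U (space ?U - ?A)"
    by (subst nn_integral_add) (simp_all only: nn_integral_cmult_indicator A sets.compl_sets[OF A] borel_measurable_times_ennreal borel_measurable_const borel_measurable_indicator)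
  also have "\<dots> = ennreal (exp s * \<tau>) + ennreal (1 - \<tau>)"
    using assms prob_compl[OF A]
    by (simp add: emeasure_eq_measure measure_unif_circle_arc_mod ennreal_mult)
  also have "\<dots> = ennreal (1 + \<tau> * (exp s - 1))"
    using assms by (subst ennreal_plus[symmetric]) (auto simp: algebra_simps)
  finally show ?thesis .
qed

lemma mgf_unif_arc:
  assumes "\<theta> \<in> {0..<2*pi}" "0 < \<tau>"
  shows "(\<integral>\<^sup>+x. ennreal (exp (s * indicat_real (arc_mod \<theta> \<tau>) x)) \<partial>unif (arc_mod \<theta> \<tau>)) = ennreal (exp s)"
proof -
  interpret prob_space "unif (arc_mod \<theta> \<tau>)" by (rule prob_space_unif_arc[OF assms])
  have "AE x in unif (arc_mod \<theta> \<tau>). x \<in> arc_mod \<theta> \<tau>"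
    unfolding unif_def by (rule AE_uniform_measureI) auto
  then have "AE x in unif (arc_mod \<theta> \<tau>).
      ennreal (exp (s * indicat_real (arc_mod \<theta> \<tau>) x)) = ennreal (exp s)"
    by eventually_elim simp
  then have "(\<integral>\<^sup>+x. ennreal (exp (s * indicat_real (arc_mod \<theta> \<tau>) x)) \<partial>unif (arc_mod \<theta> \<tau>)) =
      (\<integral>\<^sup>+x. ennreal (exp s) \<partial>unif (arc_mod \<theta> \<tau>))"
    by (rule nn_integral_cong_AE)
  then show ?thesis using emeasure_space_1 by simp
qed

lemma mgf_arc_count_PiM:
  assumes I: "finite I"
    and M: "\<And>i. prob_space (M i)" "\<And>i. sets (M i) = sets circle"
  shows "(\<integral>\<^sup>+x. ennreal (exp (s * real (arc_count I \<tau> x \<theta>))) \<partial>(\<Pi>\<^sub>M i\<in>I. M i)) =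
    (\<Prod>i\<in>I. \<integral>\<^sup>+x. ennreal (exp (s * indicat_real (arc_mod \<theta> \<tau>) x)) \<partial>M i)"
proof -
  interpret product_sigma_finite M
    by (intro product_sigma_finite.intro prob_space_imp_sigma_finite M)
  have "ennreal (exp (s * real (arc_count I \<tau> x \<theta>))) =
      (\<Prod>i\<in>I. ennreal (exp (s * indicat_real (arc_mod \<theta> \<tau>) (x i))))" for x
    using I by (simp only: sum_indicator_eq_arc_count[OF I, symmetric] sum_distrib_left exp_sum prod_ennreal exp_ge_zero)
  then show ?thesis
    using product_nn_integral_prod[OF I measurable_exp_indicator_arc[OF M(2)]] by simp
qed

text \<open>In the planted arc the \<open>K\<close> cluster points are counted almost surely, and each of the other \<open>N - K\<close> points is an
  independent Bernoulli variable: this is the moment generating function of \<open>K + Bin(N - K, \<tau>)\<close>.\<close>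

lemma mgf_cond_law:
  assumes S: "S \<subseteq> {..<N}" "card S = K" and \<theta>: "\<theta> \<in> {0..<2*pi}" and \<tau>: "0 < \<tau>" "\<tau> < 1"
  shows "(\<integral>\<^sup>+x. ennreal (exp (s * real (arc_count {..<N} \<tau> x \<theta>))) \<partial>cond_law N \<tau> S \<theta>) =
    ennreal (exp (s * real K) * (1 + \<tau> * (exp s - 1)) ^ (N - K))"
proof -
  note pos = mgf_Bernoulli_nonneg[OF \<tau>, of s]
  let ?M = "\<lambda>i. if i \<in> S then unif (arc_mod \<theta> \<tau>) else unif {0..<2*pi}"
  have "(\<integral>\<^sup>+x. ennreal (exp (s * real (arc_count {..<N} \<tau> x \<theta>))) \<partial>cond_law N \<tau> S \<theta>) =
      (\<Prod>i<N. \<integral>\<^sup>+x. ennreal (exp (s * indicat_real (arc_mod \<theta> \<tau>) x)) \<partial>?M i)"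
    unfolding cond_law_def using prob_space_unif_arc[OF \<theta> \<tau>(1)] prob_space_unif_circle
    by (intro mgf_arc_count_PiM) auto
  also have "\<dots> = (\<Prod>i<N. if i \<in> S then ennreal (exp s) else ennreal (1 + \<tau> * (exp s - 1)))"
    by (intro prod.cong refl) (simp add: mgf_unif_arc[OF \<theta> \<tau>(1)] mgf_unif_circle[OF \<theta> \<tau>])
  also have "\<dots> = ennreal (exp s) ^ card S * ennreal (1 + \<tau> * (exp s - 1)) ^ card ({..<N} - S)"
    using S by (simp add: prod.If_cases Int_absorb1 Diff_eq)
  also have "card ({..<N} - S) = N - K" using S by (subst card_Diff_subset) (auto intro: finite_subset)
  also have "ennreal (exp s) ^ card S * ennreal (1 + \<tau> * (exp s - 1)) ^ (N - K) =
      ennreal (exp (s * real K) * (1 + \<tau> * (exp s - 1)) ^ (N - K))"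
    using pos S(2) by (simp add: ennreal_power ennreal_mult exp_of_nat_mult[symmetric] mult.commute)
  finally show ?thesis .
qed

text \<open>Integrating the other coordinates with \<open>x j\<close> held fixed makes the arc deterministic. The point \<open>x j\<close>
  itself always counts, and the remaining \<open>N - 1\<close> points are independent of it, which gives
  \<open>1 + Bin(N - 1, \<tau>)\<close>.\<close>

lemma mgf_data_point_H0:
  assumes j: "j < N" and \<tau>: "0 < \<tau>" "\<tau> < 1"
  shows "(\<integral>\<^sup>+x. ennreal (exp (s * real (arc_count {..<N} \<tau> x (x j)))) \<partial>law_H0 N) =
    ennreal (exp s * (1 + \<tau> * (exp s - 1)) ^ (N - 1))"
proof -
  note pos = mgf_Bernoulli_nonneg[OF \<tau>, of s]
  let ?U = "unif {0..<2*pi}" and ?I = "{..<N} - {j}"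
  interpret product_sigma_finite "\<lambda>_::nat. ?U"
    by (intro product_sigma_finite.intro prob_space_imp_sigma_finite prob_space_unif_circle)
  interpret U: prob_space ?U by (rule prob_space_unif_circle)
  have ins: "{..<N} = insert j ?I" using j by auto
  have count: "arc_count {..<N} \<tau> (x(j := y)) y = Suc (arc_count ?I \<tau> x y)"
    if "y \<in> {0..<2*pi}" for x y
  proof -
    have "y \<in> arc_mod y \<tau>" using that \<tau> by (auto simp: arc_mod_def intro!: exI[of _ 0])
    then have "{i \<in> {..<N}. (x(j := y)) i \<in> arc_mod y \<tau>} = insert j {i \<in> ?I. x i \<in> arc_mod y \<tau>}"
      using j by auto
    then show ?thesis unfolding arc_count_def by simp
  qed
  have meas: "(\<lambda>x. ennreal (exp (s * real (arc_count {..<N} \<tau> x (x j))))) \<in>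
      borel_measurable (Pi\<^sub>M (insert j ?I) (\<lambda>_. ?U))"
  proof -
    have [measurable]: "(\<lambda>x. real (arc_count {..<N} \<tau> x (x j))) \<in> borel_measurable (data_space N)"
      using measurable_arc_count_data_point[OF j] .
    have "(\<lambda>x. ennreal (exp (s * real (arc_count {..<N} \<tau> x (x j))))) \<in> borel_measurable (data_space N)"
      by measurable
    then show ?thesis
      using sets_law_H0[of N] unfolding law_H0_def ins[symmetric] by (simp cong: measurable_cong_sets)
  qed
  have "(\<integral>\<^sup>+x. ennreal (exp (s * real (arc_count {..<N} \<tau> x (x j)))) \<partial>law_H0 N) =
      (\<integral>\<^sup>+x. ennreal (exp (s * real (arc_count {..<N} \<tau> x (x j)))) \<partial>Pi\<^sub>M (insert j ?I) (\<lambda>_. ?U))"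
    unfolding law_H0_def ins[symmetric] ..
  also have "\<dots> = (\<integral>\<^sup>+y. (\<integral>\<^sup>+x. ennreal (exp (s * real (arc_count {..<N} \<tau> (x(j := y)) y))) \<partial>Pi\<^sub>M ?I (\<lambda>_. ?U)) \<partial>?U)"
    using product_nn_integral_insert_rev[OF _ _ meas] by simp
  also have "\<dots> = (\<integral>\<^sup>+y. ennreal (exp s * (1 + \<tau> * (exp s - 1)) ^ (N - 1)) \<partial>?U)"
  proof (rule nn_integral_cong)
    fix y assume "y \<in> space ?U"
    then have y: "y \<in> {0..<2*pi}" by simp
    have [measurable]: "(\<lambda>x. real (arc_count ?I \<tau> x y)) \<in> borel_measurable (Pi\<^sub>M ?I (\<lambda>_. ?U))"
      unfolding sum_indicator_eq_arc_count[OF finite_Diff[OF finite_lessThan], symmetric]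
      by (intro borel_measurable_sum measurable_compose[OF measurable_component_singleton borel_measurable_indicator]) auto
    have "(\<integral>\<^sup>+x. ennreal (exp (s * real (arc_count {..<N} \<tau> (x(j := y)) y))) \<partial>Pi\<^sub>M ?I (\<lambda>_. ?U)) =
        (\<integral>\<^sup>+x. ennreal (exp s) * ennreal (exp (s * real (arc_count ?I \<tau> x y))) \<partial>Pi\<^sub>M ?I (\<lambda>_. ?U))"
      by (simp add: count[OF y] algebra_simps exp_add ennreal_mult)
    also have "\<dots> = ennreal (exp s) * (\<integral>\<^sup>+x. ennreal (exp (s * real (arc_count ?I \<tau> x y))) \<partial>Pi\<^sub>M ?I (\<lambda>_. ?U))"
      by (rule nn_integral_cmult) measurable
    also have "\<dots> = ennreal (exp s) * ennreal (1 + \<tau> * (exp s - 1)) ^ (N - 1)"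
      using j by (simp add: mgf_arc_count_PiM prob_space_unif_circle mgf_unif_circle[OF y \<tau>])
    also have "\<dots> = ennreal (exp s * (1 + \<tau> * (exp s - 1)) ^ (N - 1))"
      using pos by (simp add: ennreal_power ennreal_mult)
    finally show "(\<integral>\<^sup>+x. ennreal (exp (s * real (arc_count {..<N} \<tau> (x(j := y)) y))) \<partial>Pi\<^sub>M ?I (\<lambda>_. ?U)) =
        ennreal (exp s * (1 + \<tau> * (exp s - 1)) ^ (N - 1))" .
  qed
  also have "\<dots> = ennreal (exp s * (1 + \<tau> * (exp s - 1)) ^ (N - 1))"
    using U.emeasure_space_1 by simp
  finally show ?thesis .
qed

section \<open>Chernoff bounds for the two error probabilities\<close>

lemma Chernoff_bound:
  assumes [measurable]: "f \<in> borel_measurable M"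
  shows "emeasure M {x \<in> space M. a \<le> f x} \<le> ennreal (exp (- a)) * (\<integral>\<^sup>+x. ennreal (exp (f x)) \<partial>M)"
proof -
  have "emeasure M {x \<in> space M. a \<le> f x} = (\<integral>\<^sup>+x. indicator {x \<in> space M. a \<le> f x} x \<partial>M)"
    by (rule nn_integral_indicator[symmetric]) measurable
  also have "\<dots> \<le> (\<integral>\<^sup>+x. ennreal (exp (- a)) * ennreal (exp (f x)) \<partial>M)"
  proof (rule nn_integral_mono)
    fix x
    have "1 \<le> exp (- a) * exp (f x)" if "a \<le> f x"
      using that by (simp add: exp_add[symmetric])
    then show "indicator {x \<in> space M. a \<le> f x} x \<le> ennreal (exp (- a)) * ennreal (exp (f x))"
      by (auto simp: indicator_def ennreal_mult[symmetric])
  qed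
  also have "\<dots> = ennreal (exp (- a)) * (\<integral>\<^sup>+x. ennreal (exp (f x)) \<partial>M)"
    by (rule nn_integral_cmult) measurable
  finally show ?thesis .
qed

lemma power_mgf_Bernoulli_le:
  fixes \<tau> s :: real
  assumes "0 < \<tau>" "\<tau> < 1"
  shows "(1 + \<tau> * (exp s - 1)) ^ n \<le> exp (real n * \<tau> * (exp s - 1))"
proof -
  have "(1 + \<tau> * (exp s - 1)) ^ n \<le> exp (\<tau> * (exp s - 1)) ^ n"
    by (intro power_mono exp_ge_add_one_self mgf_Bernoulli_nonneg assms)
  also have "\<dots> = exp (real n * \<tau> * (exp s - 1))"
    by (simp add: exp_of_nat_mult[symmetric] mult.assoc)
  finally show ?thesis .
qed

text \<open>The union bound over the arcs starting at data points costs the factor \<open>N\<close>, and the point at the start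
  of each arc is responsible for \<open>\<gamma> - 1\<close> in place of \<open>\<gamma>\<close>.\<close>

lemma p_fa_le:
  assumes \<tau>: "0 < \<tau>" "\<tau> < 1" and \<gamma>: "0 < \<gamma>" and s: "0 \<le> s"
  shows "p_fa N (interval_test N \<tau> \<gamma>) \<le>
    real N * exp (- s * (\<gamma> - 1) + real N * \<tau> * (exp s - 1))"
proof -
  interpret H0: prob_space "law_H0 N" by (rule prob_space_law_H0)
  define b where "b = exp (- s * (\<gamma> - 1) + real N * \<tau> * (exp s - 1))"
  define B where "B j = {x \<in> space (data_space N). s * \<gamma> \<le> s * real (arc_count {..<N} \<tau> x (x j))}" for j
  have sp: "space (law_H0 N) = space (data_space N)"
    using sets_law_H0 by (rule sets_eq_imp_space_eq)
  have meas: "(\<lambda>x. s * real (arc_count {..<N} \<tau> x (x j))) \<in> borel_measurable (law_H0 N)" if "j < N" for j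
    using measurable_arc_count_data_point[OF that, of \<tau>]
    by (subst measurable_cong_sets[OF sets_law_H0 refl]) (rule borel_measurable_times, simp_all)
  have Bs: "B j \<in> sets (law_H0 N)" if "j < N" for j
    unfolding B_def sp[symmetric] using meas[OF that] by measurable
  have single: "emeasure (law_H0 N) (B j) \<le> ennreal b" if j: "j < N" for j
  proof -
    have "emeasure (law_H0 N) (B j) \<le> ennreal (exp (- (s * \<gamma>))) *
        (\<integral>\<^sup>+x. ennreal (exp (s * real (arc_count {..<N} \<tau> x (x j)))) \<partial>law_H0 N)"
      unfolding B_def sp[symmetric] by (rule Chernoff_bound[OF meas[OF j]])
    also have "\<dots> = ennreal (exp (- (s * \<gamma>)) * (exp s * (1 + \<tau> * (exp s - 1)) ^ (N - 1)))"
      unfolding mgf_data_point_H0[OF j \<tau>]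
      using mgf_Bernoulli_nonneg[OF \<tau>, of s] by (subst ennreal_mult) auto
    also have "\<dots> \<le> ennreal b"
    proof (rule ennreal_leI)
      have "exp (- (s * \<gamma>)) * (exp s * (1 + \<tau> * (exp s - 1)) ^ (N - 1)) \<le>
          exp (- (s * \<gamma>)) * (exp s * exp (real (N - 1) * \<tau> * (exp s - 1)))"
        by (intro mult_left_mono power_mgf_Bernoulli_le \<tau>) auto
      also have "\<dots> \<le> exp (- (s * \<gamma>)) * (exp s * exp (real N * \<tau> * (exp s - 1)))"
        using s \<tau> by (intro mult_left_mono) (auto intro!: mult_right_mono)
      also have "\<dots> = b" unfolding b_def by (simp add: exp_add[symmetric] algebra_simps)
      finally show "exp (- (s * \<gamma>)) * (exp s * (1 + \<tau> * (exp s - 1)) ^ (N - 1)) \<le> b" .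
    qed
    finally show ?thesis .
  qed
  have "{x \<in> space (data_space N). interval_test N \<tau> \<gamma> x = 1} \<subseteq> (\<Union>j<N. B j)"
    using interval_test_eq_1_iff_data_point[OF _ \<gamma>] s by (fastforce simp: B_def intro: mult_left_mono)
  then have "emeasure (law_H0 N) {x \<in> space (data_space N). interval_test N \<tau> \<gamma> x = 1} \<le>
      emeasure (law_H0 N) (\<Union>j<N. B j)"
    using Bs by (intro emeasure_mono) auto
  also have "\<dots> \<le> (\<Sum>j<N. emeasure (law_H0 N) (B j))"
    using Bs by (intro emeasure_subadditive_finite) auto
  also have "\<dots> \<le> (\<Sum>j<N. ennreal b)" using single by (intro sum_mono) auto
  also have "\<dots> = ennreal (real N * b)"
    by (simp add: b_def ennreal_mult ennreal_of_nat_eq_real_of_nat)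
  finally have "ennreal (p_fa N (interval_test N \<tau> \<gamma>)) \<le> ennreal (real N * b)"
    by (simp add: p_fa_def H0.emeasure_eq_measure)
  then show ?thesis by (simp add: b_def ennreal_le_iff)
qed

text \<open>The alternative is a mixture over the planted set and the planted phase, so a bound that is uniform in
  both passes to the mixture.\<close>

lemma emeasure_law_H1_le:
  assumes \<tau>: "0 < \<tau>" and K: "K \<le> N" and A: "A \<in> sets (data_space N)"
    and le: "\<And>S \<theta>. S \<subseteq> {..<N} \<Longrightarrow> card S = K \<Longrightarrow> \<theta> \<in> {0..<2*pi} \<Longrightarrow> emeasure (cond_law N \<tau> S \<theta>) A \<le> b"
  shows "emeasure (law_H1 N K \<tau>) A \<le> b"
proof -
  let ?U = "unif {0..<2*pi}"
  let ?X = "{S. S \<subseteq> {..<N} \<and> card S = K}"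
  let ?p = "pmf_of_set ?X"
  interpret U: prob_space ?U by (rule prob_space_unif_circle)
  have m: "cond_law N \<tau> S \<in> ?U \<rightarrow>\<^sub>M prob_algebra (data_space N)" for S
    using measurable_cond_law[OF \<tau>] by (simp cong: measurable_cong_sets)
  have u: "?U \<in> space (prob_algebra ?U)"
    using prob_space_unif_circle by (simp add: space_prob_algebra)
  have inner: "?U \<bind> cond_law N \<tau> S \<in> space (prob_algebra (data_space N))" for S
    using prob_space_bind'[OF u m] sets_bind'[OF u m] by (simp add: space_prob_algebra)
  have bind_le: "emeasure (?U \<bind> cond_law N \<tau> S) A \<le> b" if "S \<in> ?X" for S
  proof -
    have "emeasure (?U \<bind> cond_law N \<tau> S) A = (\<integral>\<^sup>+\<theta>. emeasure (cond_law N \<tau> S \<theta>) A \<partial>?U)"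
      by (rule emeasure_bind_prob_algebra[OF u m A])
    also have "\<dots> \<le> (\<integral>\<^sup>+\<theta>. b \<partial>?U)"
      using that by (intro nn_integral_mono le) auto
    also have "\<dots> = b" using U.emeasure_space_1 by simp
    finally show ?thesis .
  qed
  have fin: "finite ?X" by (rule finite_subset[of _ "Pow {..<N}"]) auto
  have "?X \<noteq> {}"
    using obtain_subset_with_card_n[of K "{..<N}"] K by auto
  then have supp: "set_pmf ?p = ?X" using fin by (rule set_pmf_of_set)
  have p: "measure_pmf ?p \<in> space (prob_algebra (measure_pmf ?p))"
    by (simp add: space_prob_algebra measure_pmf.prob_space_axioms)
  have "emeasure (law_H1 N K \<tau>) A = (\<integral>\<^sup>+S. emeasure (?U \<bind> cond_law N \<tau> S) A \<partial>measure_pmf ?p)"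
    unfolding law_H1_def using inner by (intro emeasure_bind_prob_algebra[OF p _ A]) simp
  also have "\<dots> \<le> (\<integral>\<^sup>+S. b \<partial>measure_pmf ?p)"
    using bind_le by (intro nn_integral_mono_AE) (auto simp: AE_measure_pmf_iff supp)
  also have "\<dots> = b" by simp
  finally show ?thesis .
qed

text \<open>When the test accepts, the planted arc in particular holds fewer than \<open>\<gamma>\<close> points. The separate
  parameter \<open>g\<close> exploits that counts are integers: for \<open>\<gamma> = K\<close> it may be \<open>K - 1\<close>, which makes the bound
  tend to \<open>0\<close> as \<open>s \<rightarrow> \<infinity>\<close>.\<close>

lemma p_miss_le:
  assumes \<tau>: "0 < \<tau>" "\<tau> < 1" and K: "K \<le> N" and s: "0 \<le> s"
    and g: "\<And>n::nat. real n < \<gamma> \<Longrightarrow> real n \<le> g"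
  shows "p_miss N K \<tau> (interval_test N \<tau> \<gamma>) \<le>
    exp (s * (g - real K) + real (N - K) * \<tau> * (exp (- s) - 1))"
proof -
  interpret H1: prob_space "law_H1 N K \<tau>" by (rule prob_space_law_H1[OF \<tau>(1)])
  define A where "A = {x \<in> space (data_space N). interval_test N \<tau> \<gamma> x = 0}"
  define b where "b = exp (s * (g - real K) + real (N - K) * \<tau> * (exp (- s) - 1))"
  have A: "A \<in> sets (data_space N)"
    using measurable_sets[OF is_test_interval_test[of N \<tau> \<gamma>, unfolded is_test_def], of "{0}"]
    by (simp add: A_def vimage_def Int_def conj_commute)
  have "emeasure (law_H1 N K \<tau>) A \<le> ennreal b"
  proof (rule emeasure_law_H1_le[OF \<tau>(1) K A])
    fix S \<theta> assume S: "S \<subseteq> {..<N}" "card S = K" and \<theta>: "\<theta> \<in> {0..<2*pi}"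
    let ?C = "cond_law N \<tau> S \<theta>" and ?c = "\<lambda>x. real (arc_count {..<N} \<tau> x \<theta>)"
    have sp: "space ?C = space (data_space N)"
      using sets_cond_law by (rule sets_eq_imp_space_eq)
    have "?c \<in> borel_measurable (data_space N)"
      unfolding sum_indicator_eq_arc_count[OF finite_lessThan, symmetric] data_space_def
      by (intro borel_measurable_sum measurable_compose[OF measurable_component_singleton borel_measurable_indicator]) auto
    then have meas: "(\<lambda>x. - s * ?c x) \<in> borel_measurable ?C"
      by (subst measurable_cong_sets[OF sets_cond_law refl]) (rule borel_measurable_times, simp_all)
    have "A \<subseteq> {x \<in> space ?C. - s * g \<le> - s * ?c x}"
    proof
      fix x assume "x \<in> A"
      then have "x \<in> space ?C" "\<not> \<gamma> \<le> ?c x"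
        using interval_test_eq_1_iff[of N \<tau> \<gamma> x] \<theta> by (auto simp: A_def sp)
      then show "x \<in> {x \<in> space ?C. - s * g \<le> - s * ?c x}"
        using g[of "arc_count {..<N} \<tau> x \<theta>"] s by (auto intro!: mult_left_mono)
    qed
    then have "emeasure ?C A \<le> emeasure ?C {x \<in> space ?C. - s * g \<le> - s * ?c x}"
      using meas by (intro emeasure_mono) auto
    also have "\<dots> \<le> ennreal (exp (- (- s * g))) * (\<integral>\<^sup>+x. ennreal (exp (- s * ?c x)) \<partial>?C)"
      by (rule Chernoff_bound[OF meas])
    also have "\<dots> = ennreal (exp (s * g) * (exp (- s * real K) * (1 + \<tau> * (exp (- s) - 1)) ^ (N - K)))"
      unfolding mgf_cond_law[OF S \<theta> \<tau>]
      using mgf_Bernoulli_nonneg[OF \<tau>, of "- s"] by (subst ennreal_mult) auto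
    also have "\<dots> \<le> ennreal b"
    proof (rule ennreal_leI)
      have "exp (s * g) * (exp (- s * real K) * (1 + \<tau> * (exp (- s) - 1)) ^ (N - K)) \<le>
          exp (s * g) * (exp (- s * real K) * exp (real (N - K) * \<tau> * (exp (- s) - 1)))"
        by (intro mult_left_mono power_mgf_Bernoulli_le \<tau>) auto
      also have "\<dots> = b" unfolding b_def by (simp add: exp_add[symmetric] algebra_simps)
      finally show "exp (s * g) * (exp (- s * real K) * (1 + \<tau> * (exp (- s) - 1)) ^ (N - K)) \<le> b" .
    qed
    finally show "emeasure ?C A \<le> ennreal b" .
  qed
  then have "ennreal (p_miss N K \<tau> (interval_test N \<tau> \<gamma>)) \<le> ennreal b"
    by (simp add: p_miss_def A_def H1.emeasure_eq_measure)
  then show ?thesis by (simp add: b_def ennreal_le_iff)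
qed

text \<open>From \<open>(1 - s + s\<^sup>2) (1 + s) = 1 + s\<^sup>3 \<ge> 1\<close> and \<open>1 + s \<le> e\<^sup>s\<close>.\<close>

lemma exp_neg_le_quadratic:
  fixes s :: real
  assumes "0 \<le> s"
  shows "exp (- s) \<le> 1 - s + s\<^sup>2"
proof -
  have "1 \<le> (1 - s + s\<^sup>2) * (1 + s)"
    using assms by (simp add: algebra_simps power2_eq_square)
  also have "\<dots> \<le> (1 - s + s\<^sup>2) * exp s"
  proof (intro mult_left_mono exp_ge_add_one_self)
    have "1 - s + s\<^sup>2 = (1/2 - s)\<^sup>2 + 3/4" by (simp add: power2_eq_square algebra_simps)
    then show "0 \<le> 1 - s + s\<^sup>2" by simp
  qed
  finally show ?thesis by (simp add: exp_minus field_simps)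
qed

text \<open>The threshold lies \<open>c\<close> times \<open>sqrt \<mu>\<close> below the mean \<open>K + \<mu>\<close> of the planted count, where
  \<open>\<mu> = (N - K) \<tau>\<close> also bounds the variance: a Gaussian lower tail.\<close>

lemma p_miss_threshold_le:
  assumes \<tau>: "0 < \<tau>" "\<tau> < 1" and K: "K < N" and c: "0 \<le> c"
  shows "p_miss N K \<tau> (interval_test N \<tau> (threshold N K \<tau> c)) \<le> exp (- c\<^sup>2 / 4)"
proof -
  define \<mu> where "\<mu> = (real N - real K) * \<tau>"
  have \<mu>: "0 < \<mu>" using K \<tau> by (simp add: \<mu>_def)
  \<comment> \<open>The minimiser of \<open>- s c sqrt \<mu> + \<mu> s\<^sup>2\<close>.\<close>
  define s where "s = c / (2 * sqrt \<mu>)"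
  have s: "0 \<le> s" using c \<mu> by (simp add: s_def)
  have \<gamma>: "threshold N K \<tau> c = \<mu> + real K - c * sqrt \<mu>"
    by (simp add: threshold_def \<mu>_def)
  have "p_miss N K \<tau> (interval_test N \<tau> (threshold N K \<tau> c)) \<le>
      exp (s * (threshold N K \<tau> c - real K) + real (N - K) * \<tau> * (exp (- s) - 1))"
    using K by (intro p_miss_le \<tau> s) auto
  also have "\<dots> \<le> exp (s * (\<mu> - c * sqrt \<mu>) + \<mu> * (- s + s\<^sup>2))"
    using exp_neg_le_quadratic[OF s] \<tau> K by (auto simp: \<gamma> \<mu>_def of_nat_diff intro!: mult_left_mono)
  also have "s * (\<mu> - c * sqrt \<mu>) + \<mu> * (- s + s\<^sup>2) = - (s * c * sqrt \<mu>) + \<mu> * s\<^sup>2"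
    by (simp add: algebra_simps)
  also have "\<dots> = - c\<^sup>2 / 4"
    using \<mu> by (simp add: s_def power_divide power_mult_distrib power2_eq_square)
  finally show ?thesis .
qed

text \<open>A form of the false alarm bound for deviations \<open>D\<close> above the mean \<open>N \<tau>\<close> that are small enough for a
  quadratic bound on \<open>e\<^sup>s\<close> to be adequate. The linear term of the expansion cancels the mean.\<close>

lemma p_fa_le_exp_quadratic:
  assumes \<tau>: "0 < \<tau>" "\<tau> < 1" and s: "0 \<le> s" and q: "exp s \<le> 1 + s + q * s\<^sup>2"
    and D: "0 \<le> D" "D \<le> \<gamma> - 1 - real N * \<tau>"
  shows "p_fa N (interval_test N \<tau> \<gamma>) \<le> real N * exp (- s * D + q * (real N * \<tau> * s\<^sup>2))"
proof -
  have "0 \<le> real N * \<tau>" using \<tau> by simp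
  then have "p_fa N (interval_test N \<tau> \<gamma>) \<le> real N * exp (- s * (\<gamma> - 1) + real N * \<tau> * (exp s - 1))"
    using D by (intro p_fa_le \<tau> s) linarith
  also have "\<dots> \<le> real N * exp (- s * (D + real N * \<tau>) + real N * \<tau> * (s + q * s\<^sup>2))"
  proof -
    have "- s * (\<gamma> - 1) \<le> - s * (D + real N * \<tau>)" using s D by (simp add: mult_left_mono)
    moreover have "real N * \<tau> * (exp s - 1) \<le> real N * \<tau> * (s + q * s\<^sup>2)"
      using \<tau> q by (intro mult_left_mono) auto
    ultimately show ?thesis by (intro mult_left_mono) auto
  qed
  also have "\<dots> = real N * exp (- s * D + q * (real N * \<tau> * s\<^sup>2))"
    by (simp add: algebra_simps)
  finally show ?thesis .
qed

section \<open>The asymptotic regimes\<close>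

lemma nonneg_tendsto_0_of_eventually_le:
  fixes f g :: "nat \<Rightarrow> real"
  assumes "\<And>N. 0 \<le> f N" "\<forall>\<^sub>F N in sequentially. f N \<le> g N" "g \<longlonglongrightarrow> 0"
  shows "f \<longlonglongrightarrow> 0"
  using assms by (intro tendsto_sandwich[of "\<lambda>_. 0" f sequentially g 0]) auto

lemma strongly_detects_intervalI:
  assumes "\<forall>\<^sub>F N in sequentially. p_fa N (interval_test N (\<tau> N) (\<gamma> N)) \<le> a N" "a \<longlonglongrightarrow> 0"
    and "\<forall>\<^sub>F N in sequentially. p_miss N (K N) (\<tau> N) (interval_test N (\<tau> N) (\<gamma> N)) \<le> b N" "b \<longlonglongrightarrow> 0"
  shows "strongly_detects K \<tau> (\<lambda>N. interval_test N (\<tau> N) (\<gamma> N))"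
  unfolding strongly_detects_def
  using nonneg_tendsto_0_of_eventually_le[OF _ assms(1,2)] nonneg_tendsto_0_of_eventually_le[OF _ assms(3,4)]
  by (simp add: is_test_interval_test p_fa_def p_miss_def)

lemma rounded_power_bounds:
  assumes "rounded_power K \<alpha>"
  shows "real N powr \<alpha> - 1 \<le> real (K N)" "real (K N) \<le> real N powr \<alpha> + 1"
proof -
  have "0 \<le> real N powr \<alpha>" by simp
  moreover have "K N = nat \<lfloor>real N powr \<alpha>\<rfloor> \<or> K N = nat \<lceil>real N powr \<alpha>\<rceil>"
    using assms by (simp add: rounded_power_def)
  ultimately show "real N powr \<alpha> - 1 \<le> real (K N)" "real (K N) \<le> real N powr \<alpha> + 1" by linarith+
qed

text \<open>With threshold \<open>K\<close> the test looks for \<open>K\<close> points in one arc. The expected number of such clusters under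
  the null hypothesis is of order \<open>N (N \<tau>) powr (K - 1)\<close>, the \<open>(K - 1)\<close>-st power of the ratio \<open>r\<close> that vanishes
  by hypothesis.\<close>

lemma strongly_detects_fixed_size:
  fixes K :: nat and \<tau> :: "nat \<Rightarrow> real"
  assumes K: "2 \<le> K" and \<tau>: "\<forall>\<^sub>F N in sequentially. 0 < \<tau> N \<and> \<tau> N < 1"
    and small: "\<tau> \<in> o(\<lambda>N. real N powr (- 1 - 1 / (real K - 1)))"
  shows "strongly_detects (\<lambda>_. K) \<tau> (\<lambda>N. interval_test N (\<tau> N) (real K))"
proof (rule strongly_detects_intervalI)
  define r where "r N = \<tau> N / real N powr (- 1 - 1 / (real K - 1))" for N
  have r: "r \<longlonglongrightarrow> 0" using smalloD_tendsto[OF small] by (simp add: r_def[abs_def])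
  have \<tau>_eq: "\<tau> N = r N * real N powr (- 1 - 1 / (real K - 1))" if "0 < N" for N
    using that by (simp add: r_def)
  show "(\<lambda>N. exp 1 * r N ^ (K - 1)) \<longlonglongrightarrow> 0"
    using K by (intro tendsto_mult_right_zero tendsto_null_power r) auto
  have "\<forall>\<^sub>F N in sequentially. r N < 1" using r by (rule order_tendstoD) simp
  with \<tau> eventually_gt_at_top[of 0]
  show "\<forall>\<^sub>F N in sequentially. p_fa N (interval_test N (\<tau> N) (real K)) \<le> exp 1 * r N ^ (K - 1)"
  proof eventually_elim
    case (elim N)
    have pos: "0 < real N * \<tau> N" using elim by simp
    have mean: "real N * \<tau> N = r N * real N powr (- (1 / (real K - 1)))"
      using elim by (simp add: \<tau>_eq powr_diff powr_minus field_simps)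
    have "r N * real N powr (- (1 / (real K - 1))) \<le> 1 * 1"
    proof (intro mult_mono)
      have "real N powr (- (1 / (real K - 1))) \<le> real N powr 0"
        using elim K by (intro powr_mono) auto
      then show "real N powr (- (1 / (real K - 1))) \<le> 1" using elim by simp
    qed (use elim in auto)
    then have le1: "real N * \<tau> N \<le> 1" unfolding mean by simp
    \<comment> \<open>The choice \<open>e\<^sup>s = 1 / (N \<tau>)\<close> is optimal up to a constant factor.\<close>
    define s where "s = - ln (real N * \<tau> N)"
    have s: "0 \<le> s" using le1 pos by (simp add: s_def)
    have es: "exp s = 1 / (real N * \<tau> N)" using pos by (simp add: s_def exp_minus divide_inverse)
    have "p_fa N (interval_test N (\<tau> N) (real K)) \<le>
        real N * exp (- s * (real K - 1) + real N * \<tau> N * (exp s - 1))"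
      using elim K by (intro p_fa_le s) auto
    also have "\<dots> \<le> real N * exp (real (K - 1) * ln (real N * \<tau> N) + 1)"
    proof (intro mult_left_mono exp_le_cancel_iff[THEN iffD2] add_mono)
      show "- s * (real K - 1) \<le> real (K - 1) * ln (real N * \<tau> N)"
        using K by (simp add: s_def of_nat_diff)
      show "real N * \<tau> N * (exp s - 1) \<le> 1" unfolding es using pos by (simp add: right_diff_distrib)
    qed simp
    also have "\<dots> = exp 1 * (real N * (real N * \<tau> N) ^ (K - 1))"
      using pos by (simp add: exp_add exp_of_nat_mult)
    also have "real N * (real N * \<tau> N) ^ (K - 1) = r N ^ (K - 1)"
    proof -
      have "(real N powr (- (1 / (real K - 1)))) ^ (K - 1) = real N powr (- 1)"
        using elim K by (simp add: powr_power of_nat_diff)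
      then show ?thesis
        using elim unfolding mean power_mult_distrib by (simp add: powr_minus)
    qed
    finally show ?case .
  qed
  show "(\<lambda>N. exp (- real N)) \<longlonglongrightarrow> 0" by real_asymp
  from \<tau> eventually_ge_at_top[of K]
  show "\<forall>\<^sub>F N in sequentially. p_miss N K (\<tau> N) (interval_test N (\<tau> N) (real K)) \<le> exp (- real N)"
  proof eventually_elim
    case (elim N)
    have "p_miss N K (\<tau> N) (interval_test N (\<tau> N) (real K)) \<le>
      exp (real N * (real (K - 1) - real K) + real (N - K) * \<tau> N * (exp (- real N) - 1))"
      using elim by (intro p_miss_le) auto
    also have "\<dots> \<le> exp (- real N)"
      using elim K by (auto simp: of_nat_diff mult_nonneg_nonpos)
    finally show ?case .
  qed
qed

text \<open>Misses are under control whenever \<open>c\<close> diverges, so only false alarms depend on the regime.\<close>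

lemma strongly_detects_thresholdI:
  assumes c: "filterlim c at_top sequentially"
    and ev: "\<forall>\<^sub>F N in sequentially. 0 < \<tau> N \<and> \<tau> N < 1 \<and> K N < N"
    and fa: "\<forall>\<^sub>F N in sequentially. p_fa N (interval_test N (\<tau> N) (threshold N (K N) (\<tau> N) (c N))) \<le> a N"
      "a \<longlonglongrightarrow> 0"
  shows "strongly_detects K \<tau> (\<lambda>N. interval_test N (\<tau> N) (threshold N (K N) (\<tau> N) (c N)))"
proof (rule strongly_detects_intervalI[OF fa])
  have "\<forall>\<^sub>F N in sequentially. 0 \<le> c N" using c by (simp add: filterlim_at_top)
  with ev show "\<forall>\<^sub>F N in sequentially.
      p_miss N (K N) (\<tau> N) (interval_test N (\<tau> N) (threshold N (K N) (\<tau> N) (c N))) \<le> exp (- (c N)\<^sup>2 / 4)"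
    by eventually_elim (rule p_miss_threshold_le, auto)
  have "((\<lambda>x::real. exp (- x\<^sup>2 / 4)) \<longlongrightarrow> 0) at_top" by real_asymp
  then show "(\<lambda>N. exp (- (c N)\<^sup>2 / 4)) \<longlonglongrightarrow> 0" using c by (rule filterlim_compose)
qed

lemma threshold_excess_ge:
  assumes "0 \<le> \<tau>" "K \<le> N" "0 \<le> c"
  shows "real K - real K * \<tau> - c * sqrt (real N * \<tau>) - 1 \<le> threshold N K \<tau> c - 1 - real N * \<tau>"
proof -
  have "c * sqrt ((real N - real K) * \<tau>) \<le> c * sqrt (real N * \<tau>)"
    using assms by (intro mult_left_mono real_sqrt_le_mono mult_right_mono) auto
  then show ?thesis by (simp add: threshold_def algebra_simps)
qed

text \<open>Here \<open>\<tau>\<close> sits at the critical scale: both \<open>s K\<close> and \<open>N \<tau> s\<^sup>2\<close> equal \<open>(2 + \<epsilon>) ln N\<close> at the Gaussian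
  optimum \<open>s\<close>, and the exponent is about \<open>- (1 + \<epsilon>/2) ln N\<close> against the \<open>ln N\<close> of the union bound. The
  relative errors of all approximations are kept below \<open>\<eta> = \<epsilon>/12\<close>, small enough to preserve
  \<open>(1 + \<epsilon>/2) (1 - 3 \<eta>) \<ge> 1 + \<epsilon>/8\<close>.\<close>

lemma strongly_detects_size_le_sqrt:
  fixes K :: "nat \<Rightarrow> nat" and \<tau> c :: "nat \<Rightarrow> real"
  assumes \<alpha>: "0 < \<alpha>" "\<alpha> \<le> 1/2" and \<epsilon>: "0 < \<epsilon>" "\<epsilon> < 1/2" and K: "rounded_power K \<alpha>"
    and \<tau>: "\<forall>\<^sub>F N in sequentially. \<tau> N = (real (K N))\<^sup>2 / ((2 + \<epsilon>) * real N * ln (real N))"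
    and c: "filterlim c at_top sequentially" "c \<in> o(\<lambda>N. sqrt (ln (real N)))"
  shows "strongly_detects K \<tau> (\<lambda>N. interval_test N (\<tau> N) (threshold N (K N) (\<tau> N) (c N)))"
proof (rule strongly_detects_thresholdI[OF c(1)])
  note lo = rounded_power_bounds(1)[OF K] and up = rounded_power_bounds(2)[OF K]
  define \<eta> where "\<eta> = \<epsilon> / 12"
  have \<eta>: "0 < \<eta>" "\<eta> < 1" using \<epsilon> by (auto simp: \<eta>_def)
  have K_pos: "\<forall>\<^sub>F N in sequentially. 0 < real (K N) \<and> 4 / \<eta> \<le> real (K N)"
  proof -
    have "filterlim (\<lambda>N::nat. real N powr \<alpha>) at_top sequentially" using \<alpha> by real_asymp
    then have "\<forall>\<^sub>F N in sequentially. max 2 (4 / \<eta> + 1) \<le> real N powr \<alpha>"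
      unfolding filterlim_at_top by blast
    then show ?thesis
    proof eventually_elim
      case (elim N)
      then show ?case using lo[of N] by auto
    qed
  qed
  have K_less: "\<forall>\<^sub>F N in sequentially. K N < N"
  proof -
    have "\<forall>\<^sub>F N::nat in sequentially. real N powr (1/2) + 1 < real N" by real_asymp
    with eventually_ge_at_top[of 1] show ?thesis
    proof eventually_elim
      case (elim N)
      then have "real N powr \<alpha> \<le> real N powr (1/2)" using \<alpha> by (intro powr_mono) auto
      then show ?case using up[of N] elim by linarith
    qed
  qed
  have \<tau>_small: "\<forall>\<^sub>F N in sequentially. 0 < \<tau> N \<and> \<tau> N < \<eta> / 4"
  proof -
    have "\<forall>\<^sub>F N::nat in sequentially. (real N powr (1/2) + 1)\<^sup>2 / (2 * real N * ln (real N)) < \<eta> / 4"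
      using \<eta> by real_asymp
    with \<tau> K_pos eventually_gt_at_top[of 1] show ?thesis
    proof eventually_elim
      case (elim N)
      have "real N powr \<alpha> \<le> real N powr (1/2)" using \<alpha> elim by (intro powr_mono) auto
      then have "(real (K N))\<^sup>2 \<le> (real N powr (1/2) + 1)\<^sup>2" using up[of N] by (intro power_mono) auto
      then have "\<tau> N \<le> (real N powr (1/2) + 1)\<^sup>2 / (2 * real N * ln (real N))"
        using elim \<epsilon> by (auto intro!: frac_le mult_right_mono)
      moreover have "0 < \<tau> N" using elim \<epsilon> by auto
      ultimately show ?case using elim by linarith
    qed
  qed
  show "\<forall>\<^sub>F N in sequentially. 0 < \<tau> N \<and> \<tau> N < 1 \<and> K N < N"
    using \<tau>_small K_less by eventually_elim (use \<eta> in auto)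
  \<comment> \<open>This is \<open>K / (N \<tau>)\<close>. It tends to \<open>0\<close> because \<open>K\<close> outgrows \<open>ln N\<close>.\<close>
  define s where "s N = (2 + \<epsilon>) * ln (real N) / real (K N)" for N
  have s: "\<forall>\<^sub>F N in sequentially. 0 \<le> s N \<and> exp (s N) \<le> 1 + s N + (1 + \<eta>) / 2 * (s N)\<^sup>2"
  proof -
    have "\<forall>\<^sub>F x in at_right (0::real). exp x \<le> 1 + x + (1 + \<eta>) / 2 * x\<^sup>2"
      using \<eta> by real_asymp
    then obtain \<delta> where \<delta>: "0 < \<delta>" "\<And>x. 0 < x \<Longrightarrow> x < \<delta> \<Longrightarrow> exp x \<le> 1 + x + (1 + \<eta>) / 2 * x\<^sup>2"
      unfolding eventually_at_right_field by auto
    have "\<forall>\<^sub>F N::nat in sequentially. (2 + \<epsilon>) * ln (real N) / (real N powr \<alpha> - 1) < \<delta>"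
      using \<alpha> \<epsilon> \<delta>(1) by real_asymp
    moreover have "\<forall>\<^sub>F N::nat in sequentially. 0 < real N powr \<alpha> - 1" using \<alpha> by real_asymp
    ultimately show ?thesis using K_pos eventually_gt_at_top[of 1]
    proof eventually_elim
      case (elim N)
      have "s N \<le> (2 + \<epsilon>) * ln (real N) / (real N powr \<alpha> - 1)"
        unfolding s_def using elim lo[of N] \<epsilon> by (intro divide_left_mono) auto
      then have "s N < \<delta>" using elim by linarith
      moreover have "0 < s N" unfolding s_def using elim \<epsilon> by auto
      ultimately show ?case using \<delta>(2)[of "s N"] by auto
    qed
  qed
  have c_small: "\<forall>\<^sub>F N in sequentially. \<bar>c N\<bar> \<le> \<eta> / 4 * sqrt (ln (real N))"
  proof -
    have "\<forall>\<^sub>F N in sequentially. norm (c N) \<le> \<eta> / 4 * norm (sqrt (ln (real N)))"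
      using landau_o.smallD[OF c(2), of "\<eta> / 4"] \<eta> by simp
    with eventually_ge_at_top[of 1] show ?thesis by eventually_elim simp
  qed
  have c_nonneg: "\<forall>\<^sub>F N in sequentially. 0 \<le> c N" using c(1) by (simp add: filterlim_at_top)
  show "\<forall>\<^sub>F N in sequentially. p_fa N (interval_test N (\<tau> N) (threshold N (K N) (\<tau> N) (c N))) \<le>
      exp (- (\<epsilon> / 8) * ln (real N))"
    using \<tau> K_pos K_less \<tau>_small s c_small c_nonneg eventually_gt_at_top[of 1]
  proof eventually_elim
    case (elim N)
    define k where "k = real (K N)"
    define L where "L = ln (real N)"
    have k: "0 < k" and L: "0 < L" using elim by (auto simp: k_def L_def)
    have \<tau>_bounds: "0 < \<tau> N" "\<tau> N < 1" using elim(4) \<eta> by linarith+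
    have mean: "real N * \<tau> N = k\<^sup>2 / ((2 + \<epsilon>) * L)"
    proof -
      have "0 < real N" "0 < 2 + \<epsilon>" using elim \<epsilon> by auto
      moreover have "\<tau> N = k\<^sup>2 / ((2 + \<epsilon>) * real N * L)"
        unfolding k_def L_def by (rule elim(1))
      ultimately show ?thesis using L by (simp add: divide_simps mult_ac)
    qed
    have "c N * sqrt (real N * \<tau> N) \<le> \<eta> / 4 * k"
    proof -
      have "sqrt (real N * \<tau> N) \<le> k / sqrt L"
      proof -
        have "k\<^sup>2 / ((2 + \<epsilon>) * L) \<le> k\<^sup>2 / L"
          using L \<epsilon> by (intro divide_left_mono) auto
        then have "sqrt (real N * \<tau> N) \<le> sqrt (k\<^sup>2 / L)" unfolding mean by simp
        then show ?thesis using k by (simp add: real_sqrt_divide)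
      qed
      moreover have "c N \<le> \<eta> / 4 * sqrt L" using elim by (simp add: L_def)
      ultimately have "c N * sqrt (real N * \<tau> N) \<le> (\<eta> / 4 * sqrt L) * (k / sqrt L)"
        using elim(4)[THEN conjunct1] \<eta> L by (intro mult_mono) auto
      then show ?thesis using L by simp
    qed
    moreover have "k * \<tau> N \<le> k * (\<eta> / 4)" using elim k by (intro mult_left_mono) auto
    moreover have "1 \<le> \<eta> / 4 * k" using elim \<eta> by (simp add: k_def field_simps)
    moreover have "k - k * \<tau> N - c N * sqrt (real N * \<tau> N) - 1 \<le>
        threshold N (K N) (\<tau> N) (c N) - 1 - real N * \<tau> N"
      unfolding k_def using elim by (intro threshold_excess_ge) auto
    moreover have "0 < \<eta> * k" using \<eta> k by simp
    ultimately have D: "k * (1 - \<eta>) \<le> threshold N (K N) (\<tau> N) (c N) - 1 - real N * \<tau> N"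
      by (simp add: algebra_simps)
    have "p_fa N (interval_test N (\<tau> N) (threshold N (K N) (\<tau> N) (c N))) \<le>
        real N * exp (- s N * (k * (1 - \<eta>)) + (1 + \<eta>) / 2 * (real N * \<tau> N * (s N)\<^sup>2))"
      using elim(5) \<eta> k D by (intro p_fa_le_exp_quadratic \<tau>_bounds) auto
    also have "- s N * (k * (1 - \<eta>)) + (1 + \<eta>) / 2 * (real N * \<tau> N * (s N)\<^sup>2) =
        - (2 + \<epsilon>) * L * ((1 - 3 * \<eta>) / 2)"
    proof -
      define A where "A = (2 + \<epsilon>) * L"
      have A: "0 < A" using L \<epsilon> by (simp add: A_def)
      have sN: "s N = A / k" by (simp only: s_def k_def L_def A_def)
      have "- s N * (k * (1 - \<eta>)) = - A * (1 - \<eta>)" using k by (simp add: sN)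
      moreover have "real N * \<tau> N * (s N)\<^sup>2 = A"
        unfolding mean A_def[symmetric] sN using k A by (simp add: power2_eq_square)
      moreover have "- A * (1 - \<eta>) + (1 + \<eta>) / 2 * A = - A * ((1 - 3 * \<eta>) / 2)"
        by (simp add: algebra_simps)
      ultimately show ?thesis by (simp only: A_def mult_minus_left mult.assoc)
    qed
    also have "real N * exp (- (2 + \<epsilon>) * L * ((1 - 3 * \<eta>) / 2)) =
        exp (L - (2 + \<epsilon>) * L * ((1 - 3 * \<eta>) / 2))"
    proof -
      have "0 < real N" using elim(3) by simp
      then have "real N = exp L" by (simp add: L_def)
      moreover have "exp L * exp (- (2 + \<epsilon>) * L * ((1 - 3 * \<eta>) / 2)) =
          exp (L - (2 + \<epsilon>) * L * ((1 - 3 * \<eta>) / 2))"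
        by (simp only: exp_add[symmetric] mult_minus_left diff_conv_add_uminus)
      ultimately show ?thesis by (simp only:)
    qed
    also have "\<dots> \<le> exp (- (\<epsilon> / 8) * L)"
    proof -
      have "1 - (2 + \<epsilon>) * ((1 - 3 * \<eta>) / 2) = - \<epsilon> / 4 + \<epsilon>\<^sup>2 / 8"
        by (simp add: \<eta>_def power2_eq_square field_simps)
      also have "\<dots> \<le> - (\<epsilon> / 8)"
      proof -
        have "\<epsilon>\<^sup>2 \<le> \<epsilon> * 1" unfolding power2_eq_square using \<epsilon> by (intro mult_left_mono) auto
        then show ?thesis by linarith
      qed
      finally have "L * (1 - (2 + \<epsilon>) * ((1 - 3 * \<eta>) / 2)) \<le> L * (- (\<epsilon> / 8))"
        using L by (intro mult_left_mono) auto
      then show ?thesis by (simp add: algebra_simps)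
    qed
    finally show ?case unfolding L_def .
  qed
  show "(\<lambda>N. exp (- (\<epsilon> / 8) * ln (real N))) \<longlonglongrightarrow> 0" using \<epsilon> by real_asymp
qed

text \<open>The excess over the mean is \<open>K (1 - \<tau>)\<close> up to lower order terms, hence at least \<open>\<epsilon> K / 2\<close>. With
  \<open>D = \<epsilon> K / 2\<close> and the bound \<open>N\<close> on the variance, \<open>s = D / (2 N)\<close> minimises \<open>- s D + N s\<^sup>2\<close>.\<close>

lemma strongly_detects_size_gt_sqrt:
  fixes K :: "nat \<Rightarrow> nat" and \<tau> c :: "nat \<Rightarrow> real"
  assumes \<alpha>: "1/2 < \<alpha>" "\<alpha> < 1" and \<epsilon>: "0 < \<epsilon>" "\<epsilon> < 1" and K: "rounded_power K \<alpha>"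
    and \<tau>: "\<forall>\<^sub>F N in sequentially. 0 < \<tau> N \<and> \<tau> N \<le> 1 - \<epsilon>"
    and c: "filterlim c at_top sequentially" "c \<in> o(\<lambda>N. real (K N) / sqrt (real N * \<tau> N))"
  shows "strongly_detects K \<tau> (\<lambda>N. interval_test N (\<tau> N) (threshold N (K N) (\<tau> N) (c N)))"
proof (rule strongly_detects_thresholdI[OF c(1)])
  note lo = rounded_power_bounds(1)[OF K] and up = rounded_power_bounds(2)[OF K]
  have K_less: "\<forall>\<^sub>F N in sequentially. K N < N"
  proof -
    have "\<forall>\<^sub>F N::nat in sequentially. real N powr \<alpha> + 1 < real N" using \<alpha> by real_asymp
    then show ?thesis
    proof eventually_elim
      case (elim N)
      then show ?case using up[of N] by linarith
    qed
  qed
  show "\<forall>\<^sub>F N in sequentially. 0 < \<tau> N \<and> \<tau> N < 1 \<and> K N < N"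
    using \<tau> K_less by eventually_elim (use \<epsilon> in auto)
  have K_large: "\<forall>\<^sub>F N in sequentially. real N powr \<alpha> / 2 \<le> real (K N) \<and> 4 / \<epsilon> \<le> real (K N)"
  proof -
    have "filterlim (\<lambda>N::nat. real N powr \<alpha>) at_top sequentially" using \<alpha> by real_asymp
    then have "\<forall>\<^sub>F N in sequentially. max 2 (4 / \<epsilon> + 1) \<le> real N powr \<alpha>"
      unfolding filterlim_at_top by blast
    then show ?thesis
    proof eventually_elim
      case (elim N)
      then show ?case using lo[of N] by auto
    qed
  qed
  have c_small: "\<forall>\<^sub>F N in sequentially. norm (c N) \<le> \<epsilon> / 4 * norm (real (K N) / sqrt (real N * \<tau> N))"
    using landau_o.smallD[OF c(2), of "\<epsilon> / 4"] \<epsilon> by simp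
  have c_nonneg: "\<forall>\<^sub>F N in sequentially. 0 \<le> c N" using c(1) by (simp add: filterlim_at_top)
  show "\<forall>\<^sub>F N in sequentially. p_fa N (interval_test N (\<tau> N) (threshold N (K N) (\<tau> N) (c N))) \<le>
      real N * exp (- (\<epsilon>\<^sup>2 / 16) * ((real N powr \<alpha> / 2)\<^sup>2 / real N))"
    using \<tau> K_less K_large c_small c_nonneg
  proof eventually_elim
    case (elim N)
    define k where "k = real (K N)"
    have N: "0 < real N" using elim by auto
    have "0 < 4 / \<epsilon>" using \<epsilon> by simp
    then have kN: "k < real N" "0 < k" unfolding k_def using elim by linarith+
    have "c N * sqrt (real N * \<tau> N) \<le> \<epsilon> / 4 * k"
      using elim N by (simp add: k_def field_simps)
    moreover have "k * \<tau> N \<le> k * (1 - \<epsilon>)" using elim kN by (intro mult_left_mono) auto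
    moreover have "1 \<le> \<epsilon> / 4 * k" using elim \<epsilon> by (simp add: k_def field_simps)
    moreover have "k - k * \<tau> N - c N * sqrt (real N * \<tau> N) - 1 \<le>
        threshold N (K N) (\<tau> N) (c N) - 1 - real N * \<tau> N"
      unfolding k_def using elim by (intro threshold_excess_ge) auto
    ultimately have D: "\<epsilon> * k / 2 \<le> threshold N (K N) (\<tau> N) (c N) - 1 - real N * \<tau> N"
      by (simp add: algebra_simps)
    define s where "s = \<epsilon> * k / (4 * real N)"
    have "\<epsilon> * k \<le> 1 * real N" using \<epsilon> kN by (intro mult_mono) auto
    then have s: "0 \<le> s" "s \<le> 1" using \<epsilon> kN N by (auto simp: s_def field_simps)
    have "p_fa N (interval_test N (\<tau> N) (threshold N (K N) (\<tau> N) (c N))) \<le>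
        real N * exp (- s * (\<epsilon> * k / 2) + 1 * (real N * \<tau> N * s\<^sup>2))"
      using elim \<epsilon> kN D s exp_bound[OF s] by (intro p_fa_le_exp_quadratic) auto
    also have "\<dots> \<le> real N * exp (- s * (\<epsilon> * k / 2) + real N * 1 * s\<^sup>2)"
    proof -
      have "real N * \<tau> N * s\<^sup>2 \<le> real N * 1 * s\<^sup>2"
        using elim \<epsilon> by (intro mult_right_mono mult_left_mono) auto
      then show ?thesis by (intro mult_left_mono) auto
    qed
    also have "- s * (\<epsilon> * k / 2) + real N * 1 * s\<^sup>2 = - (\<epsilon>\<^sup>2 / 16) * (k\<^sup>2 / real N)"
      using N by (simp add: s_def power2_eq_square field_simps)
    also have "real N * exp (- (\<epsilon>\<^sup>2 / 16) * (k\<^sup>2 / real N)) \<le>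
        real N * exp (- (\<epsilon>\<^sup>2 / 16) * ((real N powr \<alpha> / 2)\<^sup>2 / real N))"
    proof -
      have "(real N powr \<alpha> / 2)\<^sup>2 \<le> k\<^sup>2" using elim by (intro power_mono) (auto simp: k_def)
      then have "\<epsilon>\<^sup>2 / 16 * ((real N powr \<alpha> / 2)\<^sup>2 / real N) \<le> \<epsilon>\<^sup>2 / 16 * (k\<^sup>2 / real N)"
        by (intro mult_left_mono divide_right_mono) auto
      then show ?thesis by (intro mult_left_mono) auto
    qed
    finally show ?case .
  qed
  show "(\<lambda>N. real N * exp (- (\<epsilon>\<^sup>2 / 16) * ((real N powr \<alpha> / 2)\<^sup>2 / real N))) \<longlonglongrightarrow> 0"
    using \<alpha> \<epsilon> by real_asymp
qed

lemma admissible_slack_size_le_sqrt: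
  "\<exists>c::nat \<Rightarrow> real. filterlim c at_top sequentially \<and> c \<in> o(\<lambda>N. sqrt (ln (real N)))"
proof (intro exI conjI)
  show "filterlim (\<lambda>N::nat. ln (ln (real N))) at_top sequentially" by real_asymp
  show "(\<lambda>N::nat. ln (ln (real N))) \<in> o(\<lambda>N. sqrt (ln (real N)))" by real_asymp
qed

lemma admissible_slack_size_gt_sqrt:
  fixes K :: "nat \<Rightarrow> nat" and \<tau> :: "nat \<Rightarrow> real"
  assumes \<alpha>: "1/2 < \<alpha>" and K: "rounded_power K \<alpha>"
    and \<tau>: "\<forall>\<^sub>F N in sequentially. 0 < \<tau> N \<and> \<tau> N \<le> 1"
  shows "\<exists>c::nat \<Rightarrow> real. filterlim c at_top sequentially \<and>
    c \<in> o(\<lambda>N. real (K N) / sqrt (real N * \<tau> N))"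
proof (intro exI conjI)
  show "filterlim (\<lambda>N::nat. ln (real N)) at_top sequentially" by real_asymp
  have "(\<lambda>N::nat. ln (real N)) \<in> o(\<lambda>N. (real N powr \<alpha> - 1) / sqrt (real N))"
    using \<alpha> by real_asymp
  also have "(\<lambda>N::nat. (real N powr \<alpha> - 1) / sqrt (real N)) \<in> O(\<lambda>N. real (K N) / sqrt (real N * \<tau> N))"
  proof (rule landau_o.bigI[of 1])
    show "\<forall>\<^sub>F N in sequentially. norm ((real N powr \<alpha> - 1) / sqrt (real N)) \<le>
        1 * norm (real (K N) / sqrt (real N * \<tau> N))"
      using \<tau> eventually_gt_at_top[of 0]
    proof eventually_elim
      case (elim N)
      have "1 \<le> real N powr \<alpha>" using elim \<alpha> by (intro ge_one_powr_ge_zero) auto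
      moreover have "sqrt (real N * \<tau> N) \<le> sqrt (real N)" using elim by simp
      ultimately have "(real N powr \<alpha> - 1) / sqrt (real N) \<le> real (K N) / sqrt (real N * \<tau> N)"
        using elim rounded_power_bounds(1)[OF K, of N] by (intro frac_le) auto
      then show ?case using elim \<open>1 \<le> real N powr \<alpha>\<close> by simp
    qed
  qed simp
  finally show "(\<lambda>N::nat. ln (real N)) \<in> o(\<lambda>N. real (K N) / sqrt (real N * \<tau> N))" .
qed

theorem corollary1:
  "(\<forall>(K::nat) (\<tau>::nat \<Rightarrow> real).
      2 \<le> K \<longrightarrow>
      (\<forall>\<^sub>F N in sequentially. 0 < \<tau> N \<and> \<tau> N < 1) \<longrightarrow>
      \<tau> \<in> o(\<lambda>N. real N powr (- 1 - 1 / (real K - 1))) \<longrightarrow>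
      (\<exists>\<gamma>::nat \<Rightarrow> real.
         strongly_detects (\<lambda>N. K) \<tau> (\<lambda>N. interval_test N (\<tau> N) (\<gamma> N)))) \<and>
   (\<forall>(\<alpha>::real) (\<epsilon>::real) (K::nat \<Rightarrow> nat) (\<tau>::nat \<Rightarrow> real).
      0 < \<alpha> \<and> \<alpha> \<le> 1/2 \<longrightarrow> 0 < \<epsilon> \<and> \<epsilon> < 1/2 \<longrightarrow>
      rounded_power K \<alpha> \<longrightarrow>
      (\<forall>\<^sub>F N in sequentially. \<tau> N = (real (K N))^2 / ((2 + \<epsilon>) * real N * ln (real N))) \<longrightarrow>
      (\<exists>c::nat \<Rightarrow> real. filterlim c at_top sequentially \<and> c \<in> o(\<lambda>N. sqrt (ln (real N)))) \<and>
      (\<forall>c::nat \<Rightarrow> real.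
         filterlim c at_top sequentially \<longrightarrow> c \<in> o(\<lambda>N. sqrt (ln (real N))) \<longrightarrow>
         strongly_detects K \<tau>
           (\<lambda>N. interval_test N (\<tau> N) (threshold N (K N) (\<tau> N) (c N))))) \<and>
   (\<forall>(\<alpha>::real) (\<epsilon>::real) (K::nat \<Rightarrow> nat) (\<tau>::nat \<Rightarrow> real).
      1/2 < \<alpha> \<and> \<alpha> < 1 \<longrightarrow> 0 < \<epsilon> \<and> \<epsilon> < 1 \<longrightarrow>
      rounded_power K \<alpha> \<longrightarrow>
      (\<forall>\<^sub>F N in sequentially. 0 < \<tau> N \<and> \<tau> N \<le> 1 - \<epsilon>) \<longrightarrow>
      (\<exists>c::nat \<Rightarrow> real. filterlim c at_top sequentially \<and>
         c \<in> o(\<lambda>N. real (K N) / sqrt (real N * \<tau> N))) \<and>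
      (\<forall>c::nat \<Rightarrow> real.
         filterlim c at_top sequentially \<longrightarrow>
         c \<in> o(\<lambda>N. real (K N) / sqrt (real N * \<tau> N)) \<longrightarrow>
         strongly_detects K \<tau>
           (\<lambda>N. interval_test N (\<tau> N) (threshold N (K N) (\<tau> N) (c N)))))"
proof (intro conjI allI impI)
  fix K :: nat and \<tau> :: "nat \<Rightarrow> real"
  assume "2 \<le> K" "\<forall>\<^sub>F N in sequentially. 0 < \<tau> N \<and> \<tau> N < 1"
    "\<tau> \<in> o(\<lambda>N. real N powr (- 1 - 1 / (real K - 1)))"
  then show "\<exists>\<gamma>::nat \<Rightarrow> real. strongly_detects (\<lambda>N. K) \<tau> (\<lambda>N. interval_test N (\<tau> N) (\<gamma> N))"
    by (intro exI[of _ "\<lambda>_. real K"] strongly_detects_fixed_size)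
next
  show "\<exists>c::nat \<Rightarrow> real. filterlim c at_top sequentially \<and> c \<in> o(\<lambda>N. sqrt (ln (real N)))"
    by (rule admissible_slack_size_le_sqrt)
next
  fix \<alpha> \<epsilon> :: real and K :: "nat \<Rightarrow> nat" and \<tau> c :: "nat \<Rightarrow> real"
  assume "0 < \<alpha> \<and> \<alpha> \<le> 1/2" "0 < \<epsilon> \<and> \<epsilon> < 1/2" "rounded_power K \<alpha>"
    "\<forall>\<^sub>F N in sequentially. \<tau> N = (real (K N))^2 / ((2 + \<epsilon>) * real N * ln (real N))"
    "filterlim c at_top sequentially" "c \<in> o(\<lambda>N. sqrt (ln (real N)))"
  then show "strongly_detects K \<tau> (\<lambda>N. interval_test N (\<tau> N) (threshold N (K N) (\<tau> N) (c N)))"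
    using strongly_detects_size_le_sqrt by blast
next
  fix \<alpha> \<epsilon> :: real and K :: "nat \<Rightarrow> nat" and \<tau> :: "nat \<Rightarrow> real"
  assume *: "1/2 < \<alpha> \<and> \<alpha> < 1" "0 < \<epsilon> \<and> \<epsilon> < 1" "rounded_power K \<alpha>"
    "\<forall>\<^sub>F N in sequentially. 0 < \<tau> N \<and> \<tau> N \<le> 1 - \<epsilon>"
  from *(4) have "\<forall>\<^sub>F N in sequentially. 0 < \<tau> N \<and> \<tau> N \<le> 1"
    by eventually_elim (use *(2) in auto)
  then show "\<exists>c::nat \<Rightarrow> real. filterlim c at_top sequentially \<and>
      c \<in> o(\<lambda>N. real (K N) / sqrt (real N * \<tau> N))"
    using * by (intro admissible_slack_size_gt_sqrt) auto
next
  fix \<alpha> \<epsilon> :: real and K :: "nat \<Rightarrow> nat" and \<tau> c :: "nat \<Rightarrow> real"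
  assume "1/2 < \<alpha> \<and> \<alpha> < 1" "0 < \<epsilon> \<and> \<epsilon> < 1" "rounded_power K \<alpha>"
    "\<forall>\<^sub>F N in sequentially. 0 < \<tau> N \<and> \<tau> N \<le> 1 - \<epsilon>"
    "filterlim c at_top sequentially" "c \<in> o(\<lambda>N. real (K N) / sqrt (real N * \<tau> N))"
  then show "strongly_detects K \<tau> (\<lambda>N. interval_test N (\<tau> N) (threshold N (K N) (\<tau> N) (c N)))"
    using strongly_detects_size_gt_sqrt by blast
qed

end
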